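(* There is a deterministic algorithm that, given a permutation $\pi$ of $[n]$ and an approximation parameter $\varepsilon\in(0,1)$, computes a $(1\pm\varepsilon)$-approximation of the number of $1324$-copies in $\pi$ in time $O(n\cdot\mathrm{poly}(\log(n)/\varepsilon))$.
   Context: A $1324$-copy in a permutation $\pi$ of $[n]$ is a quadruple of positions $a<b<c<d$ with $\pi_a<\pi_c<\pi_b<\pi_d$. A $(1\pm\varepsilon)$-approximation of $X$ is a value in $[(1-\varepsilon)X,(1+\varepsilon)X]$. Model: Word RAM. *)

theory Defs
  imports
    Complex_Main
    "HOL-Combinatorics.Permutations"
    "HOL-Computational_Algebra.Polynomial"
begin

text \<open>Permutations of \<open>[n]\<close> are functions \<open>p\<close> with \<^term>\<open>p permutes {1..n}\<close>.\<close>

definition copies_1324 :: "nat \<Rightarrow> (nat \<Rightarrow> nat) \<Rightarrow> (nat \<times> nat \<times> nat \<times> nat) set" where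
  "copies_1324 n p = {(a, b, c, d).
     a \<in> {1..n} \<and> b \<in> {1..n} \<and> c \<in> {1..n} \<and> d \<in> {1..n} \<and>
     a < b \<and> b < c \<and> c < d \<and> p a < p c \<and> p c < p b \<and> p b < p d}"

definition is_approximation :: "real \<Rightarrow> real \<Rightarrow> real \<Rightarrow> bool" where
  "is_approximation eps x v \<longleftrightarrow> v \<in> {(1 - eps) * x .. (1 + eps) * x}"

text \<open>
  Word RAM with word size \<open>w\<close>.  Words are the natural numbers below \<open>2 ^ w\<close>; since programs
  must not depend on \<open>w\<close>, the word size is a value and not a type.  A program is a finite list
  of instructions.  Register indices, constants and jump targets are fixed in the program, so it
  uses finitely many registers; the memory is addressed by register contents and therefore has
  \<open>2 ^ w\<close> accessible cells.  Every instruction costs one time unit.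
\<close>

datatype binop = Add | Sub | Mul | Div | Mod | And | Or | Xor | Shl | Shr

datatype instr =
    Const nat nat
  | Op binop nat nat nat
  | Load nat nat
  | Store nat nat
  | Jump nat
  | JumpEq nat nat nat
  | JumpLess nat nat nat

record state =
  pc :: nat
  reg :: "nat \<Rightarrow> nat"
  mem :: "nat \<Rightarrow> nat"

text \<open>Arithmetic is modulo \<open>2 ^ w\<close>; as in HOL, \<open>x div 0 = 0\<close> and \<open>x mod 0 = x\<close>.\<close>

fun eval_binop :: "nat \<Rightarrow> binop \<Rightarrow> nat \<Rightarrow> nat \<Rightarrow> nat" where
  "eval_binop w Add x y = (x + y) mod 2 ^ w"
| "eval_binop w Sub x y = (x + (2 ^ w - y)) mod 2 ^ w"
| "eval_binop w Mul x y = (x * y) mod 2 ^ w"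
| "eval_binop w Div x y = x div y"
| "eval_binop w Mod x y = x mod y"
| "eval_binop w And x y = Bit_Operations.and x y"
| "eval_binop w Or x y = Bit_Operations.or x y"
| "eval_binop w Xor x y = Bit_Operations.xor x y"
| "eval_binop w Shl x y = push_bit y x mod 2 ^ w"
| "eval_binop w Shr x y = drop_bit y x"

fun exec_instr :: "nat \<Rightarrow> instr \<Rightarrow> state \<Rightarrow> state" where
  "exec_instr w (Const r k) s =
     s\<lparr>pc := pc s + 1, reg := (reg s)(r := k mod 2 ^ w)\<rparr>"
| "exec_instr w (Op f r i j) s =
     s\<lparr>pc := pc s + 1, reg := (reg s)(r := eval_binop w f (reg s i) (reg s j))\<rparr>"
| "exec_instr w (Load r i) s =
     s\<lparr>pc := pc s + 1, reg := (reg s)(r := mem s (reg s i))\<rparr>"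
| "exec_instr w (Store i j) s =
     s\<lparr>pc := pc s + 1, mem := (mem s)(reg s i := reg s j)\<rparr>"
| "exec_instr w (Jump l) s = s\<lparr>pc := l\<rparr>"
| "exec_instr w (JumpEq i j l) s =
     s\<lparr>pc := (if reg s i = reg s j then l else pc s + 1)\<rparr>"
| "exec_instr w (JumpLess i j l) s =
     s\<lparr>pc := (if reg s i < reg s j then l else pc s + 1)\<rparr>"

text \<open>A program halts by leaving its code, for instance by jumping past its end.\<close>

definition halted :: "instr list \<Rightarrow> state \<Rightarrow> bool" where
  "halted P s \<longleftrightarrow> length P \<le> pc s"

definition step :: "nat \<Rightarrow> instr list \<Rightarrow> state \<Rightarrow> state" where
  "step w P s = (if halted P s then s else exec_instr w (P ! pc s) s)"

text \<open>
  Halting after at most \<open>t\<close> instructions with the word \<open>v\<close> in register \<open>0\<close> (halted states are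
  fixed points of \<^const>\<open>step\<close>).
\<close>

definition outputs_within :: "nat \<Rightarrow> instr list \<Rightarrow> state \<Rightarrow> nat \<Rightarrow> nat \<Rightarrow> bool" where
  "outputs_within w P s t v \<longleftrightarrow>
     (let s' = (step w P ^^ t) s in halted P s' \<and> reg s' 0 = v)"

text \<open>
  Input convention: \<open>p 1, \<dots>, p n\<close> are in the memory cells \<open>1, \<dots>, n\<close>, register \<open>0\<close> holds \<open>n\<close>,
  and register \<open>1\<close> holds the real \<open>eps \<in> (0, 1)\<close> as a fixed-point fraction, truncated to its
  first \<open>w\<close> binary digits (so it is \<open>0\<close> if \<open>eps < 2 powr - w\<close>).  Everything else is \<open>0\<close>.
\<close>

definition initial_state :: "nat \<Rightarrow> nat \<Rightarrow> (nat \<Rightarrow> nat) \<Rightarrow> real \<Rightarrow> state" where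
  "initial_state w n p eps =
     \<lparr>pc = 0,
      reg = (\<lambda>_. 0)(0 := n, 1 := nat \<lfloor>eps * 2 ^ w\<rfloor>),
      mem = (\<lambda>i. if i \<in> {1..n} then p i else 0)\<rparr>"

end

theory Submission
  imports Defs
begin

text \<open>
  The two middle points \<open>b < c\<close> of a copy form an inversion, and the inversion \<open>(b, c)\<close> extends to
  as many copies as the product of the number of points to the lower left of \<open>(b, p c)\<close> and the number
  of points to the upper right of \<open>(c, p b)\<close>.  For fixed \<open>b\<close> the first factor is monotone in \<open>p c\<close> and
  the second one in \<open>c\<close>.  Cut both ranges greedily, with binary search, into maximal intervals on which
  the factor changes by at most \<open>1 + 1 / m\<close>; there are \<open>O(m log n)\<close> of them.  On each product
  of two intervals the weight is almost constant, so it suffices to count the points in that box.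
  This takes polylogarithmic time with a table of the numbers of points in all dyadic boxes, which is
  stored at directly computed addresses: the memory is large and initially zero, so only the
  \<open>O(n (log n)\<^sup>2)\<close> nonzero entries have to be written.  Finally \<open>m\<close> is chosen of order \<open>1 / eps\<close>.
\<close>

subsection \<open>Structured programs on the word RAM\<close>

text \<open>For fixed \<open>b\<close> each factor of the weight depends on one coordinate of
  \<open>c\<close> only, which is why intervals in the two coordinates combine to boxes. Every
  estimate is from below: a box is charged with the two factors at its start, where they are
  smallest. The error is thus one-sided, and partial answers never exceed the true count, which is
  at most \<open>n ^ 4\<close>; this also excludes overflow of the accumulator. A run of zeros of a
  factor forms a single interval; after it the factor lies between 1 and \<open>n\<close>, which
  limits the number of multiplicative steps. Only lower left quadrants are queried: since
  \<open>p\<close> is a permutation, the counts of upper right quadrants follow arithmetically. With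
  \<open>K\<close> binary digits of \<open>n + 2\<close>, a query takes order \<open>K ^ 2\<close>,
  a binary search order \<open>K ^ 3\<close>, and either direction has order \<open>m * K\<close>
  intervals, whence order \<open>m ^ 2 * K ^ 5\<close> for each \<open>b\<close>. As the machine
  computes with natural numbers, ratios are compared after cross multiplication.\<close>

datatype com =
    Set nat nat
  | Bin binop nat nat nat
  | Get nat nat
  | Put nat nat
  | Seq com com  (infixr \<open>;;\<close> 60)
  | Cond nat nat com com
  | While nat nat com

fun code_size :: "com \<Rightarrow> nat" where
  "code_size (Seq c d) = code_size c + code_size d"
| "code_size (Cond i j c d) = code_size c + code_size d + 2"
| "code_size (While i j c) = code_size c + 3"
| "code_size _ = 1"

text \<open>Jump targets are absolute, so \<open>k\<close> is the address of the first emitted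
  instruction. In \<open>Cond\<close> the else branch comes first and ends with a jump over the
  other branch; hence a true test costs 1 and a false one 2. \<open>While\<close> costs 2 per round
  besides the body, and 2 for leaving.\<close>

fun compile :: "nat \<Rightarrow> com \<Rightarrow> instr list" where
  "compile k (Set r v) = [Const r v]"
| "compile k (Bin f r i j) = [Op f r i j]"
| "compile k (Get r i) = [Load r i]"
| "compile k (Put i j) = [Store i j]"
| "compile k (Seq c d) = compile k c @ compile (k + code_size c) d"
| "compile k (Cond i j c d) =
     JumpLess i j (k + code_size d + 2) # compile (k + 1) d @
     Jump (k + code_size c + code_size d + 2) # compile (k + code_size d + 2) c"
| "compile k (While i j c) =
     JumpLess i j (k + 2) # Jump (k + code_size c + 3) # compile (k + 2) c @ [Jump k]"

lemma length_compile [simp]: "length (compile k c) = code_size c"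
  by (induction c arbitrary: k) auto

type_synonym store = "nat \<Rightarrow> nat"

inductive exec :: "nat \<Rightarrow> com \<Rightarrow> store \<Rightarrow> store \<Rightarrow> nat \<Rightarrow> store \<Rightarrow> store \<Rightarrow> bool" for w where
  Set: "exec w (Set r v) R M 1 (R(r := v mod 2 ^ w)) M"
| Bin: "exec w (Bin f r i j) R M 1 (R(r := eval_binop w f (R i) (R j))) M"
| Get: "exec w (Get r i) R M 1 (R(r := M (R i))) M"
| Put: "exec w (Put i j) R M 1 R (M(R i := R j))"
| Seq: "exec w c R M t R1 M1 \<Longrightarrow> exec w d R1 M1 u R2 M2 \<Longrightarrow> exec w (Seq c d) R M (t + u) R2 M2"
| IfT: "R i < R j \<Longrightarrow> exec w c R M t R1 M1 \<Longrightarrow> exec w (Cond i j c d) R M (t + 1) R1 M1"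
| IfF: "\<not> R i < R j \<Longrightarrow> exec w d R M t R1 M1 \<Longrightarrow> exec w (Cond i j c d) R M (t + 2) R1 M1"
| WhileT: "R i < R j \<Longrightarrow> exec w c R M t R1 M1 \<Longrightarrow> exec w (While i j c) R1 M1 u R2 M2 \<Longrightarrow>
    exec w (While i j c) R M (t + u + 2) R2 M2"
| WhileF: "\<not> R i < R j \<Longrightarrow> exec w (While i j c) R M 2 R M"

lemma step_at:
  assumes "P = A @ i # B" "length A = k"
  shows "step w P \<lparr>pc = k, reg = R, mem = M\<rparr> = exec_instr w i \<lparr>pc = k, reg = R, mem = M\<rparr>"
  using assms by (simp add: step_def halted_def nth_append)

lemma funpow_trans:
  assumes "(f ^^ t) s = s1" "(f ^^ u) s1 = s2"
  shows "(f ^^ (t + u)) s = s2"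
  using assms by (metis add.commute comp_apply funpow_add)

lemma funpow_first:
  assumes "f s = s1" "(f ^^ t) s1 = s2"
  shows "(f ^^ Suc t) s = s2"
  using assms by (simp add: funpow_swap1)

lemma funpow_last:
  assumes "(f ^^ t) s = s1" "f s1 = s2"
  shows "(f ^^ Suc t) s = s2"
  using assms by simp

text \<open>The surrounding code \<open>A\<close> and \<open>B\<close> is arbitrary in the induction
  because the parts of a compound command are compiled at shifted addresses, next to their siblings
  and the jumps between them.\<close>

theorem compile_correct:
  assumes "exec w c R M t R' M'" "P = A @ compile (length A) c @ B"
  shows "(step w P ^^ t) \<lparr>pc = length A, reg = R, mem = M\<rparr> =
    \<lparr>pc = length A + code_size c, reg = R', mem = M'\<rparr>"
  using assms
proof (induction arbitrary: A B rule: exec.induct)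
  case (Seq c R M t R1 M1 d u R2 M2)
  have "(step w P ^^ t) \<lparr>pc = length A, reg = R, mem = M\<rparr> =
    \<lparr>pc = length A + code_size c, reg = R1, mem = M1\<rparr>"
    using Seq.IH(1)[of A "compile (length A + code_size c) d @ B"] Seq.prems by simp
  moreover have "(step w P ^^ u) \<lparr>pc = length A + code_size c, reg = R1, mem = M1\<rparr> =
    \<lparr>pc = length A + code_size c + code_size d, reg = R2, mem = M2\<rparr>"
    using Seq.IH(2)[of "A @ compile (length A) c" B] Seq.prems by simp
  ultimately show ?case
    using funpow_trans by (metis add.assoc code_size.simps(1))
next
  case (IfT R i j c M t R1 M1 d)
  let ?A = "A @ JumpLess i j (length A + code_size d + 2) # compile (length A + 1) d @
     [Jump (length A + code_size c + code_size d + 2)]"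
  have "step w P \<lparr>pc = length A, reg = R, mem = M\<rparr> =
      \<lparr>pc = length A + code_size d + 2, reg = R, mem = M\<rparr>"
    using IfT.hyps IfT.prems by (subst step_at[of P A]) auto
  moreover have "(step w P ^^ t) \<lparr>pc = length A + code_size d + 2, reg = R, mem = M\<rparr> =
    \<lparr>pc = length A + code_size d + 2 + code_size c, reg = R1, mem = M1\<rparr>"
    using IfT.IH[of ?A B] IfT.prems by simp
  ultimately show ?case
    by (simp add: funpow_swap1 add_ac)
next
  case (IfF R i j d M t R1 M1 c)
  let ?e = "length A + code_size c + code_size d + 2"
  let ?h = "JumpLess i j (length A + code_size d + 2)"
  have "step w P \<lparr>pc = length A, reg = R, mem = M\<rparr> = \<lparr>pc = length A + 1, reg = R, mem = M\<rparr>"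
    using IfF.hyps IfF.prems by (subst step_at[of P A]) auto
  moreover have "(step w P ^^ t) \<lparr>pc = length A + 1, reg = R, mem = M\<rparr> =
    \<lparr>pc = length A + 1 + code_size d, reg = R1, mem = M1\<rparr>"
    using IfF.IH[of "A @ [?h]"] IfF.prems by simp
  moreover have "step w P \<lparr>pc = length A + 1 + code_size d, reg = R1, mem = M1\<rparr> =
    \<lparr>pc = ?e, reg = R1, mem = M1\<rparr>"
    using IfF.prems by (subst step_at[of P "A @ ?h # compile (length A + 1) d" "Jump ?e"
      "compile (length A + code_size d + 2) c @ B"]) auto
  ultimately have "(step w P ^^ Suc (Suc t)) \<lparr>pc = length A, reg = R, mem = M\<rparr> =
    \<lparr>pc = ?e, reg = R1, mem = M1\<rparr>"
    by (metis funpow_first funpow_last)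
  then show ?case
    by (simp add: add_ac)
next
  case (WhileT R i j c M t R1 M1 u R2 M2)
  let ?A = "A @ [JumpLess i j (length A + 2), Jump (length A + code_size c + 3)]"
  have "step w P \<lparr>pc = length A, reg = R, mem = M\<rparr> = \<lparr>pc = length A + 2, reg = R, mem = M\<rparr>"
    using WhileT.hyps WhileT.prems by (subst step_at[of P A]) auto
  moreover have "(step w P ^^ t) \<lparr>pc = length A + 2, reg = R, mem = M\<rparr> =
    \<lparr>pc = length A + 2 + code_size c, reg = R1, mem = M1\<rparr>"
    using WhileT.IH(1)[of ?A "Jump (length A) # B"] WhileT.prems by simp
  moreover have "step w P \<lparr>pc = length A + 2 + code_size c, reg = R1, mem = M1\<rparr> =
    \<lparr>pc = length A, reg = R1, mem = M1\<rparr>"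
    using WhileT.prems by (subst step_at[of P "?A @ compile (length A + 2) c" "Jump (length A)" B]) auto
  ultimately have "(step w P ^^ Suc (Suc t)) \<lparr>pc = length A, reg = R, mem = M\<rparr> =
    \<lparr>pc = length A, reg = R1, mem = M1\<rparr>"
    by (metis funpow_first funpow_last)
  moreover have "(step w P ^^ u) \<lparr>pc = length A, reg = R1, mem = M1\<rparr> =
    \<lparr>pc = length A + code_size (While i j c), reg = R2, mem = M2\<rparr>"
    using WhileT.IH(2)[OF WhileT.prems] .
  ultimately have "(step w P ^^ (Suc (Suc t) + u)) \<lparr>pc = length A, reg = R, mem = M\<rparr> =
    \<lparr>pc = length A + code_size (While i j c), reg = R2, mem = M2\<rparr>"
    by (rule funpow_trans)
  then show ?case by simp
next
  case (WhileF R i j c M)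
  let ?h = "JumpLess i j (length A + 2)"
  have "step w P \<lparr>pc = length A, reg = R, mem = M\<rparr> = \<lparr>pc = length A + 1, reg = R, mem = M\<rparr>"
    using WhileF.hyps WhileF.prems by (subst step_at[of P A]) auto
  moreover have "step w P \<lparr>pc = length A + 1, reg = R, mem = M\<rparr> =
    \<lparr>pc = length A + code_size c + 3, reg = R, mem = M\<rparr>"
    using WhileF.prems by (subst step_at[of P "A @ [?h]" "Jump (length A + code_size c + 3)"
       "compile (length A + 2) c @ Jump (length A) # B"]) auto
  ultimately show ?case
    by (simp add: numeral_2_eq_2)
qed (auto simp: step_at)

section \<open>Weakest preconditions for total correctness with running time\<close>

definition wp :: "nat \<Rightarrow> com \<Rightarrow> (nat \<Rightarrow> store \<Rightarrow> store \<Rightarrow> bool) \<Rightarrow> store \<Rightarrow> store \<Rightarrow> bool" where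
  "wp w c Q R M \<longleftrightarrow> (\<exists>t R' M'. exec w c R M t R' M' \<and> Q t R' M')"

inductive_cases exec_elims:
  "exec w (Set r v) R M t R' M'" "exec w (Bin f r i j) R M t R' M'" "exec w (Get r i) R M t R' M'"
  "exec w (Put i j) R M t R' M'" "exec w (Seq c d) R M t R' M'" "exec w (Cond i j c d) R M t R' M'"

lemma wp_simps [simp]:
  "wp w (Set r v) Q R M = Q 1 (R(r := v mod 2 ^ w)) M"
  "wp w (Bin f r i j) Q R M = Q 1 (R(r := eval_binop w f (R i) (R j))) M"
  "wp w (Get r i) Q R M = Q 1 (R(r := M (R i))) M"
  "wp w (Put i j) Q R M = Q 1 R (M(R i := R j))"
  "wp w (Seq c d) Q R M = wp w c (\<lambda>t. wp w d (\<lambda>u. Q (t + u))) R M"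
  "wp w (Cond i j c d) Q R M =
    (if R i < R j then wp w c (\<lambda>t. Q (t + 1)) R M else wp w d (\<lambda>t. Q (t + 2)) R M)"
proof -
  show "wp w (Cond i j c d) Q R M =
    (if R i < R j then wp w c (\<lambda>t. Q (t + 1)) R M else wp w d (\<lambda>t. Q (t + 2)) R M)"
    unfolding wp_def by (cases "R i < R j") (auto 4 4 intro: exec.intros elim: exec_elims)
qed (unfold wp_def, (fastforce intro: exec.intros elim: exec_elims)+)

lemma wp_mono:
  assumes "wp w c Q R M" "\<And>t R' M'. Q t R' M' \<Longrightarrow> Q' t R' M'"
  shows "wp w c Q' R M"
  using assms unfolding wp_def by blast

text \<open>As \<open>wp\<close> asserts that an execution exists, termination must be shown: the
  variant is \<open>B - k\<close>, where \<open>k\<close> counts the rounds. A round pays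
  \<open>T\<close> for the body and 2 for the test and the jump back; leaving the loop pays
  2.\<close>

lemma wp_while:
  assumes "I 0 R M"
    and "\<And>k R M. I k R M \<Longrightarrow> R i < R j \<Longrightarrow>
      k < B \<and> wp w c (\<lambda>t R' M'. t \<le> T \<and> I (Suc k) R' M') R M"
  shows "wp w (While i j c)
    (\<lambda>t R' M'. t \<le> B * (T + 2) + 2 \<and> \<not> R' i < R' j \<and> (\<exists>k. I k R' M')) R M"
proof -
  have "\<exists>t R' M'. exec w (While i j c) R M t R' M' \<and> t \<le> (B - k) * (T + 2) + 2 \<and>
      \<not> R' i < R' j \<and> (\<exists>k. I k R' M')" if "I k R M" "B - k = d" for k d R M
    using that
  proof (induction d arbitrary: k R M)
    case 0
    then have "\<not> R i < R j" using assms(2)[of k R M] by auto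
    then have "exec w (While i j c) R M 2 R M" by (rule exec.WhileF)
    with \<open>\<not> R i < R j\<close> 0(1) show ?case by (intro exI[of _ 2] exI[of _ R] exI[of _ M]) auto
  next
    case (Suc d)
    show ?case
    proof (cases "R i < R j")
      case False
      then have "exec w (While i j c) R M 2 R M" by (rule exec.WhileF)
      with False Suc.prems(1) show ?thesis
        by (intro exI[of _ 2] exI[of _ R] exI[of _ M]) auto
    next
      case True
      then obtain t R1 M1 where 1: "exec w c R M t R1 M1" "t \<le> T" "I (Suc k) R1 M1"
        using assms(2)[OF Suc.prems(1)] unfolding wp_def by blast
      have d: "B - Suc k = d" using Suc.prems(2) by simp
      obtain u R2 M2 where 2: "exec w (While i j c) R1 M1 u R2 M2"
        "u \<le> (B - Suc k) * (T + 2) + 2" "\<not> R2 i < R2 j" "\<exists>k. I k R2 M2"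
        using Suc.IH[OF 1(3) d] by blast
      have "exec w (While i j c) R M (t + u + 2) R2 M2"
        using True 1 2 exec.WhileT by blast
      moreover have "t + u + 2 \<le> (B - k) * (T + 2) + 2"
        using 1(2) 2(2) unfolding d Suc.prems(2) by simp
      ultimately show ?thesis using 2 by blast
    qed
  qed
  from this[OF assms(1)] show ?thesis unfolding wp_def by force
qed

subsection \<open>A table of dyadic counts\<close>

text \<open>The summand \<open>N\<close>, larger than \<open>n\<close>, keeps the table clear of the input cells.\<close>

definition adr :: "nat \<Rightarrow> nat \<Rightarrow> nat \<Rightarrow> nat \<Rightarrow> nat \<Rightarrow> nat" where
  "adr N k l a c = ((k * N + l) * N + a) * N + c + N"

text \<open>Up to the summand \<open>N\<close>, an address is a number written in base
  \<open>N\<close> with the digits \<open>k\<close>, \<open>l\<close>, \<open>a\<close>,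
  \<open>c\<close>; they are recovered from the last to the first.\<close>

lemma adr_inj:
  assumes "adr N k l a c = adr N k' l' a' c'"
    and "l < N" "a < N" "c < N" "l' < N" "a' < N" "c' < N"
  shows "k = k' \<and> l = l' \<and> a = a' \<and> c = c'"
proof -
  have cut: "x = x' \<and> y = y'" if "x * N + y = x' * N + y'" "y < N" "y' < N" for x x' y y'
  proof -
    have "(x * N + y) div N = x" "(x' * N + y') div N = x'"
      using that(2,3) by (simp_all add: div_add1_eq)
    then have "x = x'" using that(1) by metis
    then show ?thesis using that(1) by simp
  qed
  have 1: "((k * N + l) * N + a) * N + c = ((k' * N + l') * N + a') * N + c'"
    using assms(1) by (simp add: adr_def)
  note 2 = cut[OF 1 \<open>c < N\<close> \<open>c' < N\<close>]
  note 3 = cut[OF conjunct1[OF 2] \<open>a < N\<close> \<open>a' < N\<close>]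
  note 4 = cut[OF conjunct1[OF 3] \<open>l < N\<close> \<open>l' < N\<close>]
  show ?thesis
    using 2 3 4 by blast
qed

section \<open>Binary digits and dyadic splitting\<close>

definition levels :: "nat \<Rightarrow> nat" where
  "levels N = (LEAST k. N < 2 ^ k)"

text \<open>The right-hand side is the guard of a loop that halves a copy of \<open>N\<close> until
  it is 0. Such a loop makes \<open>levels N\<close> rounds, so the program never has to compute
  this number.\<close>

lemma less_levels_iff: "k < levels N \<longleftrightarrow> 0 < N div 2 ^ k"
proof -
  have *: "N < 2 ^ levels N" unfolding levels_def by (rule LeastI_ex) (metis less_exp)
  have "k < levels N \<longleftrightarrow> 2 ^ k \<le> N"
  proof
    assume "k < levels N"
    then show "2 ^ k \<le> N" unfolding levels_def using not_less_Least linorder_not_less by blast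
  next
    assume "2 ^ k \<le> N"
    then have "(2::nat) ^ k < 2 ^ levels N" using * by linarith
    then show "k < levels N" by simp
  qed
  then show ?thesis by (simp add: div_greater_zero_iff)
qed

lemma levels_le: "levels N \<le> N"
proof -
  have "\<not> N < levels N" by (simp add: less_levels_iff)
  then show ?thesis by simp
qed

text \<open>One step of reading the bound \<open>a\<close> in binary: the values below
  \<open>a\<close> come in pairs with a common half, except for \<open>a - 1\<close> when
  \<open>a\<close> is odd. Iterated, this cuts a prefix into dyadic intervals, one for each binary
  digit 1 of \<open>a\<close>.\<close>

lemma card_half_split:
  fixes g :: "'a \<Rightarrow> nat"
  assumes "finite S"
  shows "card {j \<in> S. g j < a} =
    card {j \<in> S. g j div 2 < a div 2} + (if odd a then card {j \<in> S. g j = a - 1} else 0)"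
proof (cases "odd a")
  case True
  then have "{j \<in> S. g j < a} = {j \<in> S. g j div 2 < a div 2} \<union> {j \<in> S. g j = a - 1}"
    "{j \<in> S. g j div 2 < a div 2} \<inter> {j \<in> S. g j = a - 1} = {}"
    by (auto elim!: oddE)
  then show ?thesis using assms True by (simp add: card_Un_disjoint)
next
  case False
  then have "{j \<in> S. g j < a} = {j \<in> S. g j div 2 < a div 2}" by (auto elim!: evenE)
  then show ?thesis using False by simp
qed

lemma div_exp_Suc: "x div 2 ^ Suc k = x div 2 ^ k div (2::nat)"
  by (metis div_mult2_eq power_Suc2)

lemma sub_mod: "y \<le> x \<Longrightarrow> x < W \<Longrightarrow> (x + (W - y)) mod W = x - (y::nat)"
proof -
  assume "y \<le> x" "x < W"
  then have "x + (W - y) = (x - y) + W" "x - y < W" by auto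
  then show ?thesis by simp
qed

text \<open>
  Registers: \<open>0\<close> accumulates the answer, \<open>2\<close> to \<open>8\<close> hold the constants of \<open>env\<close>, \<open>9\<close> and
  \<open>10\<close> the current position \<open>b\<close> and \<open>p b\<close>, and \<open>11\<close> holds \<open>n + 1\<close>.  The macro \<open>query\<close>
  takes its arguments in \<open>40\<close> and \<open>41\<close> and answers in \<open>42\<close>.  The macro \<open>greedy b\<close> uses
  \<open>b + 3\<close> (start of the interval), \<open>b + 4\<close> (exclusive end of the whole range), \<open>b + 5\<close> (value
  at the start), \<open>b + 6\<close> and \<open>b + 7\<close> (bracket of the last point of the interval), \<open>b + 8\<close>
  (argument of the evaluated function, which answers in \<open>39\<close>), \<open>b + 9\<close> (successor of the lower
  end of the bracket) and \<open>b + 10\<close> (largest admissible value, scaled by \<open>m\<close>).  A macro called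
  by another one overwrites only register \<open>0\<close> and registers above those of its caller, so that
  frame conditions are bounds on register indices; the one exception is the loop bound of
  \<open>fill_table\<close> in register \<open>19\<close>.
\<close>

locale instance_1324 =
  fixes n w m :: nat and p :: "nat \<Rightarrow> nat"
  assumes n_pos: "n \<ge> 1" and perm: "p permutes {1..n}"
    and word: "(n + 2) ^ 8 \<le> 2 ^ w" and m_le: "m + 1 \<le> (n + 2) ^ 5"
begin

definition N :: nat where "N = n + 2"
definition K :: nat where "K = levels N"

lemma N_ge: "n < N" "3 \<le> N"
  using n_pos by (simp_all add: N_def)

text \<open>The larger overflow checks reduce to powers of \<open>N\<close>: addresses stay below
  \<open>N ^ 5\<close>, and products of a function value with \<open>m\<close> or
  \<open>m + 1\<close> below \<open>N ^ 7\<close>.\<close>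

lemma pow_less_word:
  assumes "x < N ^ i" "i \<le> 8"
  shows "x < 2 ^ w"
proof -
  have "N ^ i \<le> N ^ 8" using assms N_ge by (intro power_increasing) auto
  with assms word[folded N_def] show ?thesis by linarith
qed

lemma two_less_word: "2 < (2::nat) ^ w"
  using pow_less_word[of 2 1] N_ge by simp

lemma small_less_word: "x \<le> 3 * N \<Longrightarrow> x < 2 ^ w"
proof -
  assume "x \<le> 3 * N"
  also have "3 * N \<le> N * N" using N_ge by simp
  also have "\<dots> < N * (N * N)" using N_ge by simp
  finally show ?thesis using pow_less_word[of x 3] by (simp add: eval_nat_numeral)
qed

lemma p_range: "j \<in> {1..n} \<Longrightarrow> p j \<in> {1..n}"
  using permutes_in_image[OF perm] by blast

definition env :: "store \<Rightarrow> bool" where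
  "env R \<longleftrightarrow> R 2 = n \<and> R 3 = N \<and> R 4 = 1 \<and> R 5 = 0 \<and> R 6 = 2 \<and> R 7 = m + 1 \<and> R 8 = m"

lemma envD:
  "env R \<Longrightarrow> R 2 = n" "env R \<Longrightarrow> R 3 = N" "env R \<Longrightarrow> R 4 = Suc 0"
  "env R \<Longrightarrow> R 5 = 0" "env R \<Longrightarrow> R 6 = 2"
  "env R \<Longrightarrow> R 7 = Suc m" "env R \<Longrightarrow> R 8 = m"
  unfolding env_def by simp_all

lemma env_cong:
  assumes "env R" "\<And>r. 0 < r \<Longrightarrow> r < 9 \<Longrightarrow> R' r = R r"
  shows "env R'"
  using assms unfolding env_def by simp

end

section \<open>Programs that write and read the table\<close>

definition address :: "nat \<Rightarrow> nat \<Rightarrow> nat \<Rightarrow> nat \<Rightarrow> nat \<Rightarrow> com" where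
  "address d k l a c = Bin Mul d k 3 ;; Bin Add d d l ;; Bin Mul d d 3 ;; Bin Add d d a ;;
     Bin Mul d d 3 ;; Bin Add d d c ;; Bin Add d d 3"

text \<open>Registers 11 and 14 hold the two levels, 12 and 15 the dyadic indices of the point at
  these levels. The loops are controlled by halved copies of \<open>N\<close> in 13 and 16, so that
  all levels are visited even after the index of the point has become 0.\<close>

definition insert_point :: com where
  "insert_point = Set 11 0 ;; Bin Add 12 9 5 ;; Bin Add 13 3 5 ;;
     While 5 13 (
       Set 14 0 ;; Bin Add 15 10 5 ;; Bin Add 16 3 5 ;;
       While 5 16 (
         address 17 11 14 12 15 ;; Get 18 17 ;; Bin Add 18 18 4 ;; Put 17 18 ;;
         Bin Div 15 15 6 ;; Bin Add 14 14 4 ;; Bin Div 16 16 6) ;;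
       Bin Div 12 12 6 ;; Bin Add 11 11 4 ;; Bin Div 13 13 6)"

text \<open>Every odd prefix in register 48 contributes the dyadic box whose index is one less. The
  branch \<open>Set 49 0\<close> does nothing: 49 is already 0 there.\<close>

definition query_row :: com where
  "query_row = While 5 48 (
     Bin Mod 49 48 6 ;;
     Cond 5 49 (Bin Sub 50 48 4 ;; address 51 43 47 45 50 ;; Get 52 51 ;; Bin Add 42 42 52)
       (Set 49 0) ;;
     Bin Div 48 48 6 ;; Bin Add 47 47 4)"

text \<open>The bound on positions is read in the same way; each odd prefix yields a dyadic column
  of index one less, in which \<open>query_row\<close> counts.\<close>

definition query :: com where
  "query = Set 42 0 ;; Set 43 0 ;; Bin Add 44 40 5 ;;
     While 5 44 (
       Bin Mod 46 44 6 ;;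
       Cond 5 46 (Bin Sub 45 44 4 ;; Set 47 0 ;; Bin Add 48 41 5 ;; query_row) (Set 46 0) ;;
       Bin Div 44 44 6 ;; Bin Add 43 43 4)"

context instance_1324
begin

text \<open>Horner's scheme for \<open>adr\<close>. The condition on \<open>d\<close> keeps the
  destination from overwriting an operand that is still to be read.\<close>

lemma wp_address:
  assumes "env R" "R k < N" "R l < N" "R a < N" "R c < N"
    and "d \<notin> {3, k, l, a, c}"
    and "Q (1 + (1 + (1 + (1 + (1 + (1 + 1)))))) (R(d := adr N (R k) (R l) (R a) (R c))) M"
  shows "wp w (address d k l a c) Q R M"
proof -
  have step: "x * N + y < N ^ Suc i" if "x < N ^ i" "y < N" for x y i
  proof -
    have "x * N + y < (x + 1) * N" using that by simp
    also have "\<dots> \<le> N ^ i * N" using that by (intro mult_right_mono) auto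
    finally show ?thesis by (simp add: mult.commute)
  qed
  define x1 x2 x3 where "x1 = R k * N + R l" and "x2 = x1 * N + R a" and "x3 = x2 * N + R c"
  have "x1 < N ^ 2" using step[of "R k" 1 "R l"] assms x1_def by (simp add: power2_eq_square)
  then have "x2 < N ^ 3" using step[of x1 2 "R a"] assms by (simp add: x2_def eval_nat_numeral)
  then have "x3 < N ^ 4" using step[of x2 3 "R c"] assms by (simp add: x3_def eval_nat_numeral)
  moreover have "N ^ 4 \<le> N ^ 5" using N_ge by (intro power_increasing) auto
  moreover have "x3 + N < N ^ 5"
  proof -
    have "x3 + N \<le> x3 + N * N ^ 3" using N_ge by simp
    also have "\<dots> < N ^ 4 + N ^ 4" using \<open>x3 < N ^ 4\<close> by (simp add: eval_nat_numeral)
    also have "\<dots> \<le> N * N ^ 4"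
    proof -
      have "2 * N ^ 4 \<le> N * N ^ 4" using N_ge by (intro mult_right_mono) auto
      then show ?thesis by linarith
    qed
    finally show ?thesis by (simp add: eval_nat_numeral)
  qed
  ultimately have b: "x1 < 2 ^ w" "x2 < 2 ^ w" "x3 < 2 ^ w" "x3 + N < 2 ^ w"
    using pow_less_word[of x1 2] pow_less_word[of x2 3] pow_less_word[of x3 4]
      pow_less_word[of "x3 + N" 5] \<open>x1 < N ^ 2\<close> \<open>x2 < N ^ 3\<close> by auto
  have c: "R k * N < 2 ^ w" "x1 * N < 2 ^ w" "x2 * N < 2 ^ w"
    using b unfolding x1_def x2_def x3_def by linarith+
  have "adr N (R k) (R l) (R a) (R c) = x3 + N"
    by (simp add: adr_def x1_def x2_def x3_def)
  then show ?thesis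
    using assms(6,7) b c unfolding address_def
    by (simp add: envD[OF assms(1)] x1_def[symmetric] x2_def[symmetric] x3_def[symmetric])
qed

definition dyad :: "nat \<Rightarrow> nat \<Rightarrow> nat \<Rightarrow> nat \<Rightarrow> nat" where
  "dyad k a l c = card {j \<in> {1..n}. j div 2 ^ k = a \<and> p j div 2 ^ l = c}"

definition strip :: "nat \<Rightarrow> nat \<Rightarrow> nat \<Rightarrow> nat \<Rightarrow> nat" where
  "strip k a l c = card {j \<in> {1..n}. j div 2 ^ k = a \<and> p j div 2 ^ l < c}"

definition block :: "nat \<Rightarrow> nat \<Rightarrow> nat \<Rightarrow> nat" where
  "block k a y = card {j \<in> {1..n}. j div 2 ^ k < a \<and> p j < y}"

definition below :: "nat \<Rightarrow> nat \<Rightarrow> nat" where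
  "below x y = card {j \<in> {1..n}. j < x \<and> p j < y}"

text \<open>This drives the loop of \<open>query_row\<close>: the accumulated count plus the
  remaining \<open>strip\<close> is invariant, and an odd prefix moves one table entry from the
  latter to the former.\<close>

lemma strip_split:
  "strip k a l c = strip k a (Suc l) (c div 2) + (if odd c then dyad k a l (c - 1) else 0)"
  using card_half_split[of "{j \<in> {1..n}. j div 2 ^ k = a}" "\<lambda>j. p j div 2 ^ l" c]
  unfolding strip_def dyad_def by (simp add: div_exp_Suc del: power_Suc)

lemma block_split:
  "block k a y = block (Suc k) (a div 2) y + (if odd a then strip k (a - 1) 0 y else 0)"
  using card_half_split[of "{j \<in> {1..n}. p j < y}" "\<lambda>j. j div 2 ^ k" a]
  unfolding block_def strip_def by (simp add: div_exp_Suc conj_ac del: power_Suc)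

lemma card_le_n: "card {j \<in> {1..n}. P j} \<le> n"
proof -
  have "card {j \<in> {1..n}. P j} \<le> card {1..n}" by (rule card_mono) auto
  then show ?thesis by simp
qed

definition table :: "store \<Rightarrow> bool" where
  "table M \<longleftrightarrow> (\<forall>j \<in> {1..n}. M j = p j) \<and>
     (\<forall>k<K. \<forall>l<K. \<forall>a<N. \<forall>c<N. M (adr N k l a c) = dyad k a l c)"

lemma K_less: "k < K \<Longrightarrow> k < N"
  using levels_le[of N] K_def by simp

lemma level_bound: "0 < x div 2 ^ k \<Longrightarrow> x \<le> N \<Longrightarrow> k < K"
  unfolding K_def less_levels_iff by (meson div_le_mono less_le_trans)

end

subsection \<open>Dominance counts from the table\<close>

context instance_1324
begin
lemma wp_query_row:
  assumes "env R" "table M" "R 43 < K" "R 45 < N" "R 47 = 0" "R 48 < N"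
    and "R 42 + strip (R 43) (R 45) 0 (R 48) \<le> n"
  shows "wp w query_row (\<lambda>t R' M'. t \<le> K * 20 + 2 \<and> M' = M \<and>
    (\<forall>r<47. r \<noteq> 42 \<longrightarrow> R' r = R r) \<and> R' 42 = R 42 + strip (R 43) (R 45) 0 (R 48)) R M"
proof -
  define I where "I i R' M' \<longleftrightarrow> M' = M \<and> (\<forall>r<47. r \<noteq> 42 \<longrightarrow> R' r = R r) \<and>
    R' 47 = i \<and> R' 48 = R 48 div 2 ^ i \<and>
    R' 42 + strip (R 43) (R 45) i (R 48 div 2 ^ i) = R 42 + strip (R 43) (R 45) 0 (R 48)"
    for i and R' M' :: store
  show ?thesis
    unfolding query_row_def
  proof (rule wp_mono[OF wp_while[where I = I and B = K and T = 18]])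
    show "I 0 R M" unfolding I_def using assms by simp
  next
    fix i R' M'
    assume I: "I i R' M'" and less: "R' 5 < R' 48"
    define c where "c = R 48 div 2 ^ i"
    have fr: "M' = M" "R' 47 = i" "R' 48 = c" "R' 43 = R 43" "R' 45 = R 45"
      using I unfolding I_def c_def by auto
    have E: "env R'"
      using assms(1) by (rule env_cong) (use I in \<open>auto simp: I_def\<close>)
    have "0 < c" using less envD[OF E] fr by simp
    then have iK: "i < K" unfolding c_def using assms by (intro level_bound[of "R 48"]) auto
    have cN: "c < N" unfolding c_def using assms div_le_dividend le_less_trans by blast
    have cw: "c < 2 ^ w" "i + 1 < 2 ^ w"
      using cN K_less[OF iK] small_less_word by auto
    have half: "R 48 div 2 ^ Suc i = c div 2"
      unfolding c_def by (rule div_exp_Suc)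
    have split: "strip (R 43) (R 45) i c = strip (R 43) (R 45) (Suc i) (c div 2) +
       (if odd c then dyad (R 43) (R 45) i (c - 1) else 0)" by (rule strip_split)
    have M: "M (adr N (R 43) i (R 45) (c - Suc 0)) = dyad (R 43) (R 45) i (c - Suc 0)"
      using assms iK cN unfolding table_def by auto
    have nw: "n < 2 ^ w" using pow_less_word[of n 1] N_ge by simp
    have I42: "R' 42 + strip (R 43) (R 45) i c = R 42 + strip (R 43) (R 45) 0 (R 48)"
      using I unfolding I_def c_def by simp
    have fr2: "\<And>r. r < 47 \<Longrightarrow> r \<noteq> 42 \<Longrightarrow> R' r = R r" using I unfolding I_def by simp
    show "i < K \<and> wp w (Bin Mod 49 48 6 ;;
     Cond 5 49 (Bin Sub 50 48 4 ;; address 51 43 47 45 50 ;; Get 52 51 ;; Bin Add 42 42 52)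
       (Set 49 0) ;;
     Bin Div 48 48 6 ;; Bin Add 47 47 4) (\<lambda>t R' M'. t \<le> 18 \<and> I (Suc i) R' M') R' M'"
    proof (cases "odd c")
      case True
      then have c2: "c mod 2 = Suc 0" by presburger
      have sb: "(c + 2 ^ w - Suc 0) mod 2 ^ w = c - 1"
        using sub_mod[of 1 c "2 ^ w"] cw \<open>0 < c\<close> by simp
      have add: "R' 42 + dyad (R 43) (R 45) i (c - 1) < 2 ^ w"
        using split True I42 assms(7) nw by simp
      show ?thesis
        apply (simp add: envD[OF E] fr c2 sb iK)
        apply (rule wp_address)
        subgoal using E by (simp add: env_def)
        subgoal using assms K_less by (simp add: fr)
        subgoal using iK K_less by (simp add: fr)
        subgoal using assms by (simp add: fr)
        subgoal using cN by simp
        subgoal by simp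
        subgoal using add I42 split True half cw
          by (simp add: I_def fr fr2 M envD[OF E] c2)
        done
    next
      case False
      then have c2: "c mod 2 = 0" by presburger
      show ?thesis
        using iK I42 split False half cw by (auto simp: envD[OF E] fr c2 I_def fr2)
    qed
  next
    fix t R' M'
    assume a: "t \<le> K * (18 + 2) + 2 \<and> \<not> R' 5 < R' 48 \<and> (\<exists>i. I i R' M')"
    then obtain i where I: "I i R' M'" by blast
    have E: "env R'"
      using assms(1) by (rule env_cong) (use I in \<open>auto simp: I_def\<close>)
    have "R 48 div 2 ^ i = 0" using a I envD[OF E] unfolding I_def by simp
    then show "t \<le> K * 20 + 2 \<and> M' = M \<and>
    (\<forall>r<47. r \<noteq> 42 \<longrightarrow> R' r = R r) \<and> R' 42 = R 42 + strip (R 43) (R 45) 0 (R 48)"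
      using a I unfolding I_def by (simp add: strip_def)
  qed
qed

definition query_time :: nat where "query_time = K * (K * 20 + 11) + 5"

lemma wp_query:
  assumes "env R" "table M" "R 40 < N" "R 41 < N"
  shows "wp w query (\<lambda>t R' M'. t \<le> query_time \<and> M' = M \<and>
    (\<forall>r<42. R' r = R r) \<and> R' 42 = below (R 40) (R 41)) R M"
proof -
  define I where "I i R' M' \<longleftrightarrow> M' = M \<and> (\<forall>r<42. R' r = R r) \<and>
    R' 43 = i \<and> R' 44 = R 40 div 2 ^ i \<and>
    R' 42 + block i (R 40 div 2 ^ i) (R 41) = below (R 40) (R 41)"
    for i and R' M' :: store
  define body where "body = (Bin Mod 46 44 6 ;;
       Cond 5 46 (Bin Sub 45 44 4 ;; Set 47 0 ;; Bin Add 48 41 5 ;; query_row) (Set 46 0) ;;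
       Bin Div 44 44 6 ;; Bin Add 43 43 4)"
  have loop: "wp w (While 5 44 body) (\<lambda>t R' M'. t \<le> K * (K * 20 + 11) + 2 \<and> M' = M \<and>
    (\<forall>r<42. R' r = R r) \<and> R' 42 = below (R 40) (R 41)) R1 M" if "I 0 R1 M" for R1
  proof (rule wp_mono[OF wp_while[where I = I and B = K and T = "K * 20 + 9"]])
    show "I 0 R1 M" by fact
  next
    fix i R' M'
    assume I: "I i R' M'" and less: "R' 5 < R' 44"
    define a where "a = R 40 div 2 ^ i"
    have fr: "M' = M" "R' 43 = i" "R' 44 = a" "R' 41 = R 41"
      using I unfolding I_def a_def by auto
    have E: "env R'"
      using assms(1) by (rule env_cong) (use I in \<open>auto simp: I_def\<close>)
    have "0 < a" using less envD[OF E] fr by simp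
    then have iK: "i < K" unfolding a_def using assms by (intro level_bound[of "R 40"]) auto
    have aN: "a < N" unfolding a_def using assms div_le_dividend le_less_trans by blast
    have aw: "a < 2 ^ w" "Suc i < 2 ^ w" "R 41 < 2 ^ w"
      using aN K_less[OF iK] assms small_less_word by auto
    have half: "R 40 div 2 ^ Suc i = a div 2"
      unfolding a_def by (rule div_exp_Suc)
    have split: "block i a (R 41) = block (Suc i) (a div 2) (R 41) +
       (if odd a then strip i (a - 1) 0 (R 41) else 0)" by (rule block_split)
    have Ib: "R' 42 + block i a (R 41) = below (R 40) (R 41)"
      using I unfolding I_def a_def by simp
    have le: "below (R 40) (R 41) \<le> n" unfolding below_def by (rule card_le_n)
    have fr2: "\<And>r. r < 42 \<Longrightarrow> R' r = R r" using I unfolding I_def by simp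
    show "i < K \<and> wp w body (\<lambda>t R' M'. t \<le> K * 20 + 9 \<and> I (Suc i) R' M') R' M'"
    proof (cases "odd a")
      case True
      then have a2: "a mod 2 = Suc 0" by presburger
      have sb: "(a + 2 ^ w - Suc 0) mod 2 ^ w = a - Suc 0"
        using sub_mod[of 1 a "2 ^ w"] aw \<open>0 < a\<close> by simp
      show ?thesis
        unfolding body_def
        apply (simp add: envD[OF E] fr a2 sb iK aw)
        apply (rule wp_mono[OF wp_query_row])
        subgoal using E by (simp add: env_def)
        subgoal by fact
        subgoal using iK by (simp add: fr)
        subgoal using aN by simp
        subgoal by simp
        subgoal using assms by simp
        subgoal using le Ib split True by (simp add: fr)
        subgoal for t R2 M2
          using Ib split True half aw
          by (simp add: I_def fr fr2 envD[OF E] a2)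
        done
    next
      case False
      then have a2: "a mod 2 = 0" by presburger
      show ?thesis
        unfolding body_def
        using iK Ib split False half aw by (auto simp: envD[OF E] fr a2 I_def fr2)
    qed
  next
    fix t R' M'
    assume a: "t \<le> K * (K * 20 + 9 + 2) + 2 \<and> \<not> R' 5 < R' 44 \<and> (\<exists>i. I i R' M')"
    then obtain i where I: "I i R' M'" by blast
    have E: "env R'"
      using assms(1) by (rule env_cong) (use I in \<open>auto simp: I_def\<close>)
    have "R 40 div 2 ^ i = 0" using a I envD[OF E] unfolding I_def by simp
    then show "t \<le> K * (K * 20 + 11) + 2 \<and> M' = M \<and>
    (\<forall>r<42. R' r = R r) \<and> R' 42 = below (R 40) (R 41)"
      using a I unfolding I_def by (simp add: block_def add.commute)
  qed
  have w40: "R 40 < 2 ^ w" using assms small_less_word by auto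
  show ?thesis
    unfolding query_def body_def[symmetric]
    apply (simp add: envD[OF assms(1)] w40)
    apply (rule wp_mono[OF loop])
    by (simp_all add: I_def block_def below_def query_time_def)
qed

text \<open>The indicator of the one memory cell \<open>z\<close> that counts the box of levels
  \<open>k\<close>, \<open>l\<close> around the point. With increments written as functions of
  \<open>z\<close>, the memory after the loops is the initial memory plus a sum.\<close>

definition cell :: "nat \<Rightarrow> nat \<Rightarrow> nat \<Rightarrow> nat \<Rightarrow> nat \<Rightarrow> nat" where
  "cell k l x y z = of_bool (z = adr N k l (x div 2 ^ k) (y div 2 ^ l))"

lemma wp_insert_row:
  assumes "env R" "R 11 < K" "R 12 = x div 2 ^ R 11" "x < N" "R 14 = 0" "R 15 = y" "y < N"
    "R 16 = N" and bound: "\<forall>z\<ge>N. M z + K < 2 ^ w"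
  shows "wp w (While 5 16 (
         address 17 11 14 12 15 ;; Get 18 17 ;; Bin Add 18 18 4 ;; Put 17 18 ;;
         Bin Div 15 15 6 ;; Bin Add 14 14 4 ;; Bin Div 16 16 6))
    (\<lambda>t R' M'. t \<le> K * 15 + 2 \<and> (\<forall>r<14. R' r = R r) \<and> R' 19 = R 19 \<and>
      M' = (\<lambda>z. M z + (\<Sum>l<K. cell (R 11) l x y z))) R M"
proof -
  define I where "I i R' M' \<longleftrightarrow> i \<le> K \<and> (\<forall>r<14. R' r = R r) \<and> R' 19 = R 19 \<and>
    R' 14 = i \<and> R' 15 = y div 2 ^ i \<and> R' 16 = N div 2 ^ i \<and>
    M' = (\<lambda>z. M z + (\<Sum>l<i. cell (R 11) l x y z))"
    for i and R' M' :: store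
  show ?thesis
  proof (rule wp_mono[OF wp_while[where I = I and B = K and T = 13]])
    show "I 0 R M" unfolding I_def using assms by simp
  next
    fix i R' M'
    assume I: "I i R' M'" and less: "R' 5 < R' 16"
    have E: "env R'"
      using assms(1) by (rule env_cong) (use I in \<open>auto simp: I_def\<close>)
    have iK: "i < K" using less I envD[OF E] unfolding I_def K_def less_levels_iff by simp
    have fr2: "\<And>r. r < 14 \<Longrightarrow> R' r = R r" using I unfolding I_def by simp
    have fr: "R' 14 = i" "R' 15 = y div 2 ^ i" "R' 16 = N div 2 ^ i" "R' 19 = R 19"
      "M' = (\<lambda>z. M z + (\<Sum>l<i. cell (R 11) l x y z))"
      using I unfolding I_def by auto
    define z0 where "z0 = adr N (R 11) i (x div 2 ^ R 11) (y div 2 ^ i)"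
    have lt: "x div 2 ^ R 11 < N" "y div 2 ^ i < N"
      using assms div_le_dividend le_less_trans by blast+
    have "z0 \<ge> N" unfolding z0_def adr_def by simp
    \<comment> \<open>A cell gains at most 1 per round, so the reserve \<open>K\<close> in
      \<open>bound\<close> suffices against overflow.\<close>
    have "(\<Sum>l<i. cell (R 11) l x y z0) \<le> (\<Sum>l<i. 1)"
      by (intro sum_mono) (simp add: cell_def)
    then have "M' z0 + 1 \<le> M z0 + K" using iK unfolding fr by simp
    then have val: "Suc (M' z0) < 2 ^ w" using bound \<open>z0 \<ge> N\<close> by (auto dest: spec[of _ z0])
    have iw: "Suc i < 2 ^ w" using K_less[OF iK] small_less_word by auto
    have upd: "M'(z0 := Suc (M' z0)) = (\<lambda>z. M z + (\<Sum>l<Suc i. cell (R 11) l x y z))"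
      unfolding fr by (auto simp: cell_def z0_def fun_eq_iff)
    show "i < K \<and> wp w (address 17 11 14 12 15 ;; Get 18 17 ;; Bin Add 18 18 4 ;; Put 17 18 ;;
         Bin Div 15 15 6 ;; Bin Add 14 14 4 ;; Bin Div 16 16 6)
       (\<lambda>t R' M'. t \<le> 13 \<and> I (Suc i) R' M') R' M'"
      apply (simp add: iK)
      apply (rule wp_address[OF E])
      subgoal using fr2 assms K_less by simp
      subgoal using fr iK K_less by simp
      subgoal using fr2 assms lt by simp
      subgoal using fr lt by simp
      subgoal by simp
      subgoal using val iK iw upd[unfolded z0_def, simplified] assms(3)
        by (simp add: I_def fr(1-4) fr2 envD[OF E] z0_def div_exp_Suc del: power_Suc)
      done
  next
    fix t R' M'
    assume a: "t \<le> K * (13 + 2) + 2 \<and> \<not> R' 5 < R' 16 \<and> (\<exists>i. I i R' M')"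
    then obtain i where I: "I i R' M'" by blast
    have E: "env R'"
      using assms(1) by (rule env_cong) (use I in \<open>auto simp: I_def\<close>)
    have "\<not> i < K" using a I envD[OF E] unfolding I_def K_def less_levels_iff by simp
    then have "i = K" using I unfolding I_def by simp
    then show "t \<le> K * 15 + 2 \<and> (\<forall>r<14. R' r = R r) \<and> R' 19 = R 19 \<and>
      M' = (\<lambda>z. M z + (\<Sum>l<K. cell (R 11) l x y z))"
      using a I unfolding I_def by simp
  qed
qed

end

subsection \<open>Filling the table\<close>

definition fill_table :: com where
  "fill_table = Set 9 1 ;; Bin Add 19 2 4 ;;
     While 9 19 (Get 10 9 ;; insert_point ;; Bin Add 9 9 4)"

context instance_1324
begin

definition point :: "nat \<Rightarrow> nat \<Rightarrow> nat \<Rightarrow> nat" where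
  "point x y z = (\<Sum>k<K. \<Sum>l<K. cell k l x y z)"

lemma w_pos: "0 < w"
  using two_less_word by (cases w) auto

lemma cell_row_le: "(\<Sum>l<K. cell k l x y z) \<le> K"
proof -
  have "(\<Sum>l<K. cell k l x y z) \<le> (\<Sum>l<K. 1)" by (intro sum_mono) (simp add: cell_def)
  then show ?thesis by simp
qed

text \<open>A crude bound, meant only for excluding overflow while the table is filled.\<close>

lemma point_le: "point x y z \<le> K * K"
proof -
  have "point x y z \<le> (\<Sum>k<K. K)" unfolding point_def by (intro sum_mono cell_row_le)
  then show ?thesis by simp
qed

lemma wp_insert_point:
  assumes "env R" "R 9 < N" "R 10 < N" and bound: "\<forall>z\<ge>N. M z + K * K + K < 2 ^ w"
  shows "wp w insert_point
    (\<lambda>t R' M'. t \<le> K * (K * 15 + 10) + 5 \<and> (\<forall>r<11. R' r = R r) \<and> R' 19 = R 19 \<and>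
      M' = (\<lambda>z. M z + point (R 9) (R 10) z)) R M"
proof -
  define I where "I i R' M' \<longleftrightarrow> i \<le> K \<and> (\<forall>r<11. R' r = R r) \<and> R' 19 = R 19 \<and>
    R' 11 = i \<and> R' 12 = R 9 div 2 ^ i \<and> R' 13 = N div 2 ^ i \<and>
    M' = (\<lambda>z. M z + (\<Sum>k<i. \<Sum>l<K. cell k l (R 9) (R 10) z))"
    for i and R' M' :: store
  define row where "row = While 5 16 (
         address 17 11 14 12 15 ;; Get 18 17 ;; Bin Add 18 18 4 ;; Put 17 18 ;;
         Bin Div 15 15 6 ;; Bin Add 14 14 4 ;; Bin Div 16 16 6)"
  define body where "body = (Set 14 0 ;; Bin Add 15 10 5 ;; Bin Add 16 3 5 ;; row ;;
       Bin Div 12 12 6 ;; Bin Add 11 11 4 ;; Bin Div 13 13 6)"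
  have small: "N < 2 ^ w" "R 9 < 2 ^ w" "R 10 < 2 ^ w" using small_less_word assms by auto
  have loop: "wp w (While 5 13 body)
     (\<lambda>t R' M'. t \<le> K * (K * 15 + 10) + 2 \<and> (\<forall>r<11. R' r = R r) \<and> R' 19 = R 19 \<and>
      M' = (\<lambda>z. M z + point (R 9) (R 10) z)) R1 M" if "I 0 R1 M" for R1
  proof (rule wp_mono[OF wp_while[where I = I and B = K and T = "K * 15 + 8"]])
    show "I 0 R1 M" by fact
  next
    fix i R' M'
    assume I: "I i R' M'" and less: "R' 5 < R' 13"
    have E: "env R'"
      using assms(1) by (rule env_cong) (use I in \<open>auto simp: I_def\<close>)
    have iK: "i < K" using less I envD[OF E] unfolding I_def K_def less_levels_iff by simp
    have fr2: "\<And>r. r < 11 \<Longrightarrow> R' r = R r" using I unfolding I_def by simp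
    have fr: "R' 11 = i" "R' 12 = R 9 div 2 ^ i" "R' 13 = N div 2 ^ i" "R' 19 = R 19"
      "M' = (\<lambda>z. M z + (\<Sum>k<i. \<Sum>l<K. cell k l (R 9) (R 10) z))"
      using I unfolding I_def by auto
    have b: "\<forall>z\<ge>N. M' z + K < 2 ^ w"
    proof (intro allI impI)
      fix z :: nat
      assume "N \<le> z"
      have "(\<Sum>k<i. \<Sum>l<K. cell k l (R 9) (R 10) z) \<le> (\<Sum>k<i. K)"
        by (intro sum_mono cell_row_le)
      also have "\<dots> \<le> K * K" using iK by simp
      finally show "M' z + K < 2 ^ w"
        using bound \<open>N \<le> z\<close> unfolding fr by (auto dest!: spec[of _ z])
    qed
    have iw: "Suc i < 2 ^ w" using K_less[OF iK] small_less_word by auto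
    show "i < K \<and> wp w body (\<lambda>t R' M'. t \<le> K * 15 + 8 \<and> I (Suc i) R' M') R' M'"
      unfolding body_def
      apply (simp add: iK envD[OF E] fr2 small)
      apply (unfold row_def)
      apply (rule wp_mono[OF wp_insert_row[where x = "R 9" and y = "R 10"]])
      subgoal using E by (simp add: env_def)
      subgoal using fr iK by simp
      subgoal using fr by simp
      subgoal using assms by simp
      subgoal by simp
      subgoal by simp
      subgoal using assms by simp
      subgoal by simp
      subgoal by (rule b)
      subgoal using iK iw
        by (simp add: I_def fr fr2 envD[OF E] div_exp_Suc add.assoc del: power_Suc)
      done
  next
    fix t R' M'
    assume a: "t \<le> K * (K * 15 + 8 + 2) + 2 \<and> \<not> R' 5 < R' 13 \<and> (\<exists>i. I i R' M')"
    then obtain i where I: "I i R' M'" by blast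
    have E: "env R'"
      using assms(1) by (rule env_cong) (use I in \<open>auto simp: I_def\<close>)
    have "\<not> i < K" using a I envD[OF E] unfolding I_def K_def less_levels_iff by simp
    then have "i = K" using I unfolding I_def by simp
    then show "t \<le> K * (K * 15 + 10) + 2 \<and> (\<forall>r<11. R' r = R r) \<and> R' 19 = R 19 \<and>
      M' = (\<lambda>z. M z + point (R 9) (R 10) z)"
      using a I unfolding I_def point_def by (simp add: add.commute)
  qed
  show ?thesis
    unfolding insert_point_def row_def[symmetric] body_def[symmetric]
    apply (simp add: envD[OF assms(1)] small)
    apply (rule wp_mono[OF loop])
    by (simp_all add: I_def envD[OF assms(1)])
qed

lemma point_below_table: "z < N \<Longrightarrow> point x y z = 0"
  unfolding point_def cell_def adr_def by simp

text \<open>By injectivity of addresses only the summand with exactly the levels \<open>k\<close>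
  and \<open>l\<close> can reach this cell, and the double sum collapses.\<close>

lemma point_at_adr:
  assumes "x < N" "y < N" "k < K" "l < K" "a < N" "c < N"
  shows "point x y (adr N k l a c) = of_bool (x div 2 ^ k = a \<and> y div 2 ^ l = c)"
proof -
  have lt: "x div 2 ^ i < N" "y div 2 ^ i < N" for i
    using assms div_le_dividend le_less_trans by blast+
  have "cell k' l' x y (adr N k l a c) =
    (if l' = l then if k' = k then of_bool (x div 2 ^ k = a \<and> y div 2 ^ l = c) else 0 else 0)"
    if "k' < K" "l' < K" for k' l'
    using that assms lt K_less unfolding cell_def
    by (auto dest!: adr_inj)
  then have "point x y (adr N k l a c) = (\<Sum>k'<K. \<Sum>l'<K.
    (if l' = l then if k' = k then of_bool (x div 2 ^ k = a \<and> y div 2 ^ l = c) else 0 else 0))"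
    unfolding point_def by (intro sum.cong refl) simp
  also have "\<dots> = of_bool (x div 2 ^ k = a \<and> y div 2 ^ l = c)"
    using assms by (simp add: sum.delta' sum.delta)
  finally show ?thesis .
qed

definition input_mem :: store where
  "input_mem = (\<lambda>i. if i \<in> {1..n} then p i else 0)"

text \<open>The summand \<open>N\<close> in \<open>adr\<close> separates the two terms:
  \<open>input_mem\<close> vanishes at table addresses and \<open>point\<close> vanishes at input
  cells. At a table address the sum of indicators is the number of points in the box.\<close>

lemma table_of_points: "table (\<lambda>z. input_mem z + (\<Sum>j\<in>{1..n}. point j (p j) z))"
proof -
  have "dyad k a l c = (\<Sum>j\<in>{1..n}. point j (p j) (adr N k l a c))"
    if "k < K" "l < K" "a < N" "c < N" for k a l c
  proof -
    have "(\<Sum>j\<in>{1..n}. point j (p j) (adr N k l a c)) =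
      (\<Sum>j\<in>{1..n}. of_bool (j div 2 ^ k = a \<and> p j div 2 ^ l = c))"
    proof (rule sum.cong[OF refl])
      fix j assume "j \<in> {1..n}"
      then have "j < N" "p j < N" using p_range[of j] N_ge by auto
      then show "point j (p j) (adr N k l a c) = of_bool (j div 2 ^ k = a \<and> p j div 2 ^ l = c)"
        using that by (intro point_at_adr)
    qed
    also have "\<dots> = dyad k a l c"
      unfolding dyad_def by (simp add: Int_def conj_ac)
    finally show ?thesis by simp
  qed
  moreover have "input_mem (adr N k l a c) = 0" for k l a c
    unfolding input_mem_def adr_def using N_ge by simp
  moreover have "input_mem j + (\<Sum>i\<in>{1..n}. point i (p i) j) = p j" if "j \<in> {1..n}" for j
    using that N_ge point_below_table[of j] unfolding input_mem_def by simp
  ultimately show ?thesis unfolding table_def by simp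
qed

lemma wp_fill_table:
  assumes "env R"
  shows "wp w fill_table (\<lambda>t R' M'. t \<le> n * (K * (K * 15 + 10) + 10) + 4 \<and>
    (\<forall>r<9. R' r = R r) \<and> table M') R input_mem"
proof -
  define I where "I i R' M' \<longleftrightarrow> i \<le> n \<and> (\<forall>r<9. R' r = R r) \<and> R' 9 = i + 1 \<and>
    R' 19 = n + 1 \<and> M' = (\<lambda>z. input_mem z + (\<Sum>j\<in>{1..i}. point j (p j) z))"
    for i and R' M' :: store
  define body where "body = (Get 10 9 ;; insert_point ;; Bin Add 9 9 4)"
  have small: "Suc n < 2 ^ w" "0 < w"
    using small_less_word N_ge w_pos by auto
  have loop: "wp w (While 9 19 body)
     (\<lambda>t R' M'. t \<le> n * (K * (K * 15 + 10) + 10) + 2 \<and> (\<forall>r<9. R' r = R r) \<and> table M')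
       R1 input_mem" if "I 0 R1 input_mem" for R1
  proof (rule wp_mono[OF wp_while[where I = I and B = n and T = "K * (K * 15 + 10) + 8"]])
    show "I 0 R1 input_mem" by fact
  next
    fix i R' M'
    assume I: "I i R' M'" and less: "R' 9 < R' 19"
    have E: "env R'"
      using assms(1) by (rule env_cong) (use I in \<open>auto simp: I_def\<close>)
    have ik: "i < n" using less I unfolding I_def by simp
    have fr2: "\<And>r. r < 9 \<Longrightarrow> R' r = R r" using I unfolding I_def by simp
    have fr: "R' 9 = Suc i" "R' 19 = n + 1"
      "M' = (\<lambda>z. input_mem z + (\<Sum>j\<in>{1..i}. point j (p j) z))"
      using I unfolding I_def by auto
    have Mi: "M' (Suc i) = p (Suc i)"
      using ik N_ge point_below_table[of "Suc i"] unfolding fr input_mem_def by simp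
    have pS: "p (Suc i) < N" using p_range[of "Suc i"] ik N_ge by auto
    have b: "\<forall>z\<ge>N. M' z + K * K + K < 2 ^ w"
    proof (intro allI impI)
      fix z :: nat
      assume "N \<le> z"
      have "(\<Sum>j\<in>{1..i}. point j (p j) z) \<le> (\<Sum>j\<in>{1..i}. K * K)"
        by (intro sum_mono point_le)
      also have "\<dots> = i * (K * K)" by simp
      finally have "M' z + K * K + K \<le> i * (K * K) + K * K + K"
        using \<open>N \<le> z\<close> N_ge unfolding fr input_mem_def by simp
      also have "\<dots> \<le> i * (N * N) + N * N + N"
        using levels_le[of N] unfolding K_def by (intro add_mono mult_mono) auto
      also have "\<dots> < (i + 2) * (N * N)" using N_ge by simp
      also have "\<dots> \<le> N * (N * N)" using ik by (intro mult_right_mono) (auto simp: N_def)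
      finally show "M' z + K * K + K < 2 ^ w"
        using pow_less_word[of _ 3] by (simp add: eval_nat_numeral)
    qed
    have iw: "Suc (Suc i) < 2 ^ w" using ik small by simp
    show "i < n \<and> wp w body
        (\<lambda>t R' M'. t \<le> K * (K * 15 + 10) + 8 \<and> I (Suc i) R' M') R' M'"
      unfolding body_def
      apply (simp add: ik)
      apply (rule wp_mono[OF wp_insert_point])
      subgoal using E by (simp add: env_def)
      subgoal using fr ik N_ge by simp
      subgoal using pS Mi fr by simp
      subgoal by (rule b)
      subgoal using ik iw
        by (simp add: I_def fr(1,2) fr2 Mi envD[OF E]) (simp add: fr add.assoc)
      done
  next
    fix t R' M'
    assume a: "t \<le> n * (K * (K * 15 + 10) + 8 + 2) + 2 \<and> \<not> R' 9 < R' 19 \<and> (\<exists>i. I i R' M')"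
    then obtain i where I: "I i R' M'" by blast
    then have "i = n" using a unfolding I_def by simp
    then show "t \<le> n * (K * (K * 15 + 10) + 10) + 2 \<and> (\<forall>r<9. R' r = R r) \<and> table M'"
      using a I table_of_points unfolding I_def \<open>i = n\<close> by (simp add: add.commute)
  qed
  show ?thesis
    unfolding fill_table_def body_def[symmetric]
    apply (simp add: envD[OF assms(1)] small)
    apply (rule wp_mono[OF loop])
    by (simp_all add: I_def)
qed

end

subsection \<open>Greedy partition of a monotone function\<close>

text \<open>With \<open><\<close> as the only test, the guard compares the successor of the lower
  end with the upper end: it holds as long as the bracket has an interior point.\<close>

definition search :: "nat \<Rightarrow> com \<Rightarrow> com" where
  "search b val = While (b + 9) (b + 7) (
     Bin Add (b + 8) (b + 6) (b + 7) ;; Bin Div (b + 8) (b + 8) 6 ;; val ;; Bin Mul 39 39 8 ;;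
     Cond (b + 10) 39 (Bin Add (b + 7) (b + 8) 5) (Bin Add (b + 6) (b + 8) 5) ;;
     Bin Add (b + 9) (b + 6) 4)"

text \<open>An interval from \<open>z\<close> may extend to \<open>lo\<close> when
  \<open>F lo * m \<le> F z * (m + 1)\<close>. The right-hand side is computed once per interval,
  into register \<open>b + 10\<close>.\<close>

definition greedy :: "nat \<Rightarrow> com \<Rightarrow> com \<Rightarrow> com" where
  "greedy b val body = Set (b + 3) 1 ;;
     While (b + 3) (b + 4) (
       Bin Add (b + 8) (b + 3) 5 ;; val ;; Bin Add (b + 5) 39 5 ;;
       Bin Mul (b + 10) 39 7 ;; Bin Add (b + 6) (b + 3) 5 ;; Bin Add (b + 7) (b + 4) 5 ;; Bin Add (b + 9) (b + 6) 4 ;;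
       search b val ;; body ;; Bin Add (b + 3) (b + 6) 4)"

text \<open>Even the half that is rounded up stays below half the power of two, so each bisection
  lowers the exponent by one.\<close>

lemma half_le_pow:
  assumes "d \<le> 2 ^ j" "1 < (d::nat)"
  shows "d div 2 \<le> 2 ^ (j - 1)" "d - d div 2 \<le> 2 ^ (j - 1)" "0 < j"
  using assms by (cases j; simp)+

text \<open>Limits the number of greedy intervals, since each of them multiplies the value
  by more than \<open>1 + 1 / m\<close>.\<close>

lemma geometric_bound:
  assumes "(m + 1) ^ i \<le> f * m ^ i" "m \<ge> 1" "f < 2 ^ k"
  shows "i < m * (k::nat)"
proof (rule ccontr)
  define x where "x = 1 + 1 / real m"
  assume "\<not> i < m * k"
  \<comment> \<open>By Bernoulli's inequality, \<open>m\<close> growths by \<open>1 + 1 / m\<close>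
    at least double the value.\<close>
  have "(2::real) \<le> x ^ m"
    using Bernoulli_inequality[of "1 / real m" m] assms order_trans[of "-1" 0 "1 / real m"]
    by (simp add: x_def)
  then have "2 ^ k \<le> (x ^ m) ^ k" by (intro power_mono) auto
  also have "\<dots> = x ^ (m * k)" by (simp add: power_mult)
  also have "\<dots> \<le> x ^ i" using \<open>\<not> i < m * k\<close> by (intro power_increasing) (auto simp: x_def)
  also have "\<dots> = (real m + 1) ^ i / real m ^ i"
    using assms by (simp add: x_def field_simps power_divide flip: power_mult_distrib)
  also have "\<dots> \<le> real f"
  proof -
    have "real ((m + 1) ^ i) \<le> real (f * m ^ i)" using assms(1) of_nat_le_iff by blast
    then show ?thesis using assms by (simp add: field_simps)
  qed
  finally have "real (2 ^ k) \<le> real f" by simp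
  then have "2 ^ k \<le> f" using of_nat_le_iff by blast
  with assms show False by simp
qed

text \<open>For \<open>m \<ge> 1\<close> this is a lower estimate that is off by a factor of at most
  \<open>(1 + 1 / m)\<^sup>2\<close>, cleared of denominators; the square comes from the two factors
  of a weight. Being linear in \<open>A\<close> and \<open>X\<close>, the relation survives
  summation over boxes.\<close>

definition approx :: "nat \<Rightarrow> nat \<Rightarrow> nat \<Rightarrow> bool" where
  "approx m A X \<longleftrightarrow> A \<le> X \<and> m * m * X \<le> (m + 1) * (m + 1) * A"

lemma approx_0: "approx m 0 0"
  by (simp add: approx_def)

lemma approx_add: "approx m A X \<Longrightarrow> approx m B Y \<Longrightarrow> approx m (A + B) (X + Y)"
  unfolding approx_def by (auto simp only: distrib_left intro!: add_mono)

context instance_1324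
begin

lemma N_less_pow_K: "N < 2 ^ K"
  using less_levels_iff[of K N] unfolding K_def by (simp add: div_greater_zero_iff)

text \<open>The contract for the macro passed to \<open>greedy\<close>. \<open>R0\<close> fixes the
  registers below those of the greedy loop, on which \<open>F\<close> may depend; register 0 is
  exempt because it accumulates the answer.\<close>

definition evaluates :: "com \<Rightarrow> nat \<Rightarrow> (nat \<Rightarrow> nat) \<Rightarrow> nat \<Rightarrow> nat \<Rightarrow> store \<Rightarrow> store \<Rightarrow> bool" where
  "evaluates val tv F b Z R0 M \<longleftrightarrow>
    (\<forall>R. (\<forall>r. 0 < r \<longrightarrow> r < b + 3 \<longrightarrow> R r = R0 r) \<longrightarrow> 1 \<le> R (b + 8) \<longrightarrow> R (b + 8) < Z \<longrightarrow>
      wp w val (\<lambda>t R' M'. t \<le> tv \<and> M' = M \<and> (\<forall>r<39. R' r = R r) \<and> R' 39 = F (R (b + 8))) R M)"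

text \<open>The lower end of the bracket always respects the threshold in \<open>b + 10\<close>; the
  upper end exceeds it or is \<open>Z\<close>, where \<open>F\<close> is never evaluated. The
  initial bracket is shorter than \<open>2 ^ K\<close>, hence the \<open>K\<close> rounds.\<close>

lemma wp_search:
  assumes "env R0" and base: "9 \<le> b" "b + 10 < 39"
    and val: "evaluates val tv F b Z R0 M"
    and F: "\<And>x. 1 \<le> x \<Longrightarrow> x < Z \<Longrightarrow> F x \<le> n" and "Z \<le> N"
    and ok: "\<forall>r. 0 < r \<longrightarrow> r < b + 3 \<longrightarrow> R r = R0 r"
    and "1 \<le> z" "z < Z" "R (b + 6) = z" "R (b + 7) = Z" "R (b + 9) = z + 1"
    and "F z * m \<le> R (b + 10)"
  shows "wp w (search b val) (\<lambda>t R' M'. t \<le> K * (tv + 9) + 2 \<and> M' = M \<and>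
    (\<forall>r<b + 6. R' r = R r) \<and> z \<le> R' (b + 6) \<and> R' (b + 6) < Z \<and>
    F (R' (b + 6)) * m \<le> R (b + 10) \<and>
    (R' (b + 6) + 1 = Z \<or> R (b + 10) < F (R' (b + 6) + 1) * m)) R M"
proof -
  define T where "T = R (b + 10)"
  define I where "I i R' M' \<longleftrightarrow> M' = M \<and> (\<forall>r<b + 6. R' r = R r) \<and> R' (b + 10) = T \<and>
    z \<le> R' (b + 6) \<and> R' (b + 6) < R' (b + 7) \<and> R' (b + 7) \<le> Z \<and>
    F (R' (b + 6)) * m \<le> T \<and> (R' (b + 7) = Z \<or> T < F (R' (b + 7)) * m) \<and>
    R' (b + 9) = R' (b + 6) + 1 \<and> i \<le> K \<and> R' (b + 7) - R' (b + 6) \<le> 2 ^ (K - i)"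
    for i and R' M' :: store
  show ?thesis
    unfolding search_def T_def[symmetric]
  proof (rule wp_mono[OF wp_while[where I = I and B = K and T = "tv + 7"]])
    show "I 0 R M"
      unfolding I_def using assms N_less_pow_K by (auto simp: T_def)
  next
    fix i R' M'
    assume I: "I i R' M'" and less: "R' (b + 9) < R' (b + 7)"
    define lo hi where "lo = R' (b + 6)" and "hi = R' (b + 7)"
    define mid where "mid = (lo + hi) div 2"
    have fr: "M' = M" "R' (b + 10) = T" "R' (b + 6) = lo" "R' (b + 7) = hi"
      using I unfolding I_def lo_def hi_def by auto
    have fr2: "\<And>r. r < b + 6 \<Longrightarrow> R' r = R r" using I unfolding I_def by simp
    have lh: "z \<le> lo" "lo + 1 < hi" "hi \<le> Z" "hi - lo \<le> 2 ^ (K - i)"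
      using I less unfolding I_def lo_def hi_def by auto
    have inv: "F lo * m \<le> T" "hi = Z \<or> T < F hi * m"
      using I unfolding I_def lo_def hi_def by auto
    have E: "env R'"
      using assms(1) by (rule env_cong) (use fr2 ok base in auto)
    have mid: "lo < mid" "mid < hi" using lh unfolding mid_def by auto
    have "mid - lo = (hi - lo) div 2" "hi - mid = (hi - lo) - (hi - lo) div 2"
      using lh unfolding mid_def by linarith+
    then have half: "mid - lo \<le> 2 ^ (K - Suc i)" "hi - mid \<le> 2 ^ (K - Suc i)" and iK: "i < K"
      using half_le_pow[OF lh(4)] lh(2) less_diff_conv by auto
    have lw: "lo + hi < 2 ^ w" "mid < 2 ^ w" "Suc mid < 2 ^ w" "Suc lo < 2 ^ w"
      using lh mid \<open>Z \<le> N\<close> small_less_word by auto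
    have "F mid \<le> n" by (rule F) (use mid lh \<open>1 \<le> z\<close> in auto)
    then have "F mid * m \<le> N * N ^ 5"
      using m_le[folded N_def] N_ge by (intro mult_mono) auto
    also have "\<dots> < N * N ^ 6" using N_ge by simp
    finally have Fm: "F mid * m < 2 ^ w"
      using pow_less_word[of "F mid * m" 7] by (simp add: eval_nat_numeral)
    let ?R = "R'(b + 8 := mid)"
    have v: "wp w val (\<lambda>t R2 M2. t \<le> tv \<and> M2 = M \<and> (\<forall>r<39. R2 r = ?R r) \<and> R2 39 = F mid)
      ?R M"
      using val[unfolded evaluates_def, rule_format, of ?R] fr2 ok mid lh assms by simp
    show "i < K \<and> wp w (Bin Add (b + 8) (b + 6) (b + 7) ;; Bin Div (b + 8) (b + 8) 6 ;; val ;;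
     Bin Mul 39 39 8 ;;
     Cond (b + 10) 39 (Bin Add (b + 7) (b + 8) 5) (Bin Add (b + 6) (b + 8) 5) ;;
     Bin Add (b + 9) (b + 6) 4)
      (\<lambda>t R' M'. t \<le> tv + 7 \<and> I (Suc i) R' M') R' M'"
      apply (simp add: iK fr lw envD[OF E] mid_def[symmetric])
      apply (rule wp_mono[OF v])
      subgoal for t R2 M2
      proof -
        assume a: "t \<le> tv \<and> M2 = M \<and> (\<forall>r<39. R2 r = (R'(b + 8 := mid)) r) \<and> R2 39 = F mid"
        then have fr3: "R2 r = (R'(b + 8 := mid)) r" if "r < 39" for r using that by blast
        have r: "R2 8 = m" "R2 5 = 0" "R2 4 = 1" "R2 (b + 8) = mid" "R2 (b + 6) = lo"
          "R2 (b + 7) = hi" "R2 (b + 10) = T" "R2 39 = F mid"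
          using a base envD[OF E] fr by (simp_all add: fr3)
        have r2: "R2 r = R r" if "r < b + 6" for r
          using that base fr2 by (simp add: fr3)
        show ?thesis
        proof (cases "T < F mid * m")
          case True
          then show ?thesis
            using a base lw lh Fm mid half iK inv by (simp add: r r2 I_def)
        next
          case False
          then show ?thesis
            using a base lw lh Fm mid half iK inv by (simp add: r r2 I_def)
        qed
      qed
      done
  next
    fix t R' M'
    assume a: "t \<le> K * (tv + 7 + 2) + 2 \<and> \<not> R' (b + 9) < R' (b + 7) \<and> (\<exists>i. I i R' M')"
    then obtain i where I: "I i R' M'" by blast
    then have e: "R' (b + 7) = Suc (R' (b + 6))" using a unfolding I_def by auto
    have "t \<le> K * (tv + 9) + 2" using a by (simp add: add.commute)
    with I show "t \<le> K * (tv + 9) + 2 \<and> M' = M \<and>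
    (\<forall>r<b + 6. R' r = R r) \<and> z \<le> R' (b + 6) \<and> R' (b + 6) < Z \<and>
    F (R' (b + 6)) * m \<le> T \<and>
    (R' (b + 6) + 1 = Z \<or> T < F (R' (b + 6) + 1) * m)"
      unfolding I_def e by auto
  qed
qed

definition greedy_time :: "nat \<Rightarrow> nat \<Rightarrow> nat" where
  "greedy_time tv tb = (m * K + 1) * (tv + K * (tv + 9) + tb + 12) + 3"

text \<open>\<open>H\<close> stands for any quantity that is additive over intervals, so the rule
  can be nested: outside for intervals of values, inside for intervals of positions.
  \<open>U\<close> bounds the accumulator; the body may rely on it because what has been added so
  far never exceeds the true sum.\<close>

lemma wp_greedy:
  assumes m: "1 \<le> m" and "env R0" and base: "9 \<le> b" "b + 10 < 39"
    and val: "evaluates val tv F b Z R0 M"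
    and F: "\<And>x. 1 \<le> x \<Longrightarrow> x < Z \<Longrightarrow> F x \<le> n"
    and mono: "\<And>x y. 1 \<le> x \<Longrightarrow> x \<le> y \<Longrightarrow> y < Z \<Longrightarrow> F x \<le> F y"
    and Z: "1 \<le> Z" "Z \<le> N" "R0 (b + 4) = Z"
    and H: "\<And>x y z. x \<le> y \<Longrightarrow> y \<le> z \<Longrightarrow> H x z = H x y + H y z"
    and U: "R0 0 + H 1 Z \<le> U"
    and body: "\<And>R z lo. \<lbrakk>\<forall>r. 0 < r \<longrightarrow> r < b + 3 \<longrightarrow> R r = R0 r;
      R (b + 3) = z; R (b + 6) = lo; R (b + 5) = F z;
      1 \<le> z; z \<le> lo; lo < Z; F lo * m \<le> F z * (m + 1); R 0 + H z (lo + 1) \<le> U\<rbrakk> \<Longrightarrow>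
      wp w body (\<lambda>t R' M'. t \<le> tb \<and> M' = M \<and> (\<forall>r. 0 < r \<longrightarrow> r < b + 11 \<longrightarrow> R' r = R r) \<and>
        (\<exists>A. R' 0 = R 0 + A \<and> approx m A (H z (lo + 1)))) R M"
  shows "wp w (greedy b val body) (\<lambda>t R' M'. t \<le> greedy_time tv tb \<and> M' = M \<and>
    (\<forall>r. 0 < r \<longrightarrow> r < b + 3 \<longrightarrow> R' r = R0 r) \<and>
    (\<exists>A. R' 0 = R0 0 + A \<and> approx m A (H 1 Z))) R0 M"
proof -
  have H0: "H x x = 0" for x using H[of x x x] by simp
  \<comment> \<open>The last conjunct records the growth of \<open>F\<close> at the interval starts.
    The exponent is \<open>i - 1\<close> and not \<open>i\<close>, because the first interval may
    start with the value 0.\<close>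
  define I where "I i R' M' \<longleftrightarrow> M' = M \<and> (\<forall>r. 0 < r \<longrightarrow> r < b + 3 \<longrightarrow> R' r = R0 r) \<and> R' (b + 4) = Z \<and>
    1 \<le> R' (b + 3) \<and> R' (b + 3) \<le> Z \<and>
    (\<exists>A. R' 0 = R0 0 + A \<and> approx m A (H 1 (R' (b + 3)))) \<and>
    (R' (b + 3) < Z \<longrightarrow> 0 < i \<longrightarrow> (m + 1) ^ (i - 1) \<le> F (R' (b + 3)) * m ^ (i - 1))"
    for i and R' M' :: store
  define loop where "loop = (Bin Add (b + 8) (b + 3) 5 ;; val ;; Bin Add (b + 5) 39 5 ;;
       Bin Mul (b + 10) 39 7 ;; Bin Add (b + 6) (b + 3) 5 ;; Bin Add (b + 7) (b + 4) 5 ;; Bin Add (b + 9) (b + 6) 4 ;;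
       search b val ;; body ;; Bin Add (b + 3) (b + 6) 4)"
  have main: "wp w (While (b + 3) (b + 4) loop) (\<lambda>t R' M'.
    t \<le> (m * K + 1) * (tv + K * (tv + 9) + tb + 12) + 2 \<and> M' = M \<and>
    (\<forall>r. 0 < r \<longrightarrow> r < b + 3 \<longrightarrow> R' r = R0 r) \<and>
    (\<exists>A. R' 0 = R0 0 + A \<and> approx m A (H 1 Z))) R1 M" if "I 0 R1 M" for R1
  proof (rule wp_mono[OF wp_while[where I = I and B = "m * K + 1" and
        T = "tv + K * (tv + 9) + tb + 10"]])
    show "I 0 R1 M" by fact
  next
    fix i R' M'
    assume I: "I i R' M'" and less: "R' (b + 3) < R' (b + 4)"
    define z where "z = R' (b + 3)"
    have ok: "\<And>r. 0 < r \<Longrightarrow> r < b + 3 \<Longrightarrow> R' r = R0 r" using I unfolding I_def by simp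
    have E: "env R'" using \<open>env R0\<close> by (rule env_cong) (use ok base in auto)
    have fr: "M' = M" "R' (b + 3) = z" "R' (b + 4) = Z" "1 \<le> z" "z < Z"
      using I less unfolding I_def z_def by auto
    obtain A where A: "R' 0 = R0 0 + A" "approx m A (H 1 z)"
      using I unfolding I_def z_def by auto
    have pow: "0 < i \<Longrightarrow> (m + 1) ^ (i - 1) \<le> F z * m ^ (i - 1)"
      using I fr unfolding I_def z_def by auto
    have iB: "i < m * K + 1"
    proof (cases "i = 0")
      case False
      have "F z < 2 ^ K" using F[of z] fr N_ge N_less_pow_K by linarith
      then have "i - 1 < m * K" using pow False m by (intro geometric_bound) auto
      then show ?thesis by simp
    qed simp
    have lw: "z < 2 ^ w" "Suc z < 2 ^ w" "Z < 2 ^ w" "F z < 2 ^ w"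
      using fr Z F[of z] small_less_word N_ge by auto
    have "F z * (m + 1) \<le> N * N ^ 5"
      using F[of z] fr m_le[folded N_def] N_ge by (intro mult_mono) auto
    also have "\<dots> < N * N ^ 6" using N_ge by simp
    finally have Fm: "F z * Suc m < 2 ^ w"
      using pow_less_word[of "F z * (m + 1)" 7] by (simp add: eval_nat_numeral)
    let ?R = "R'(b + 8 := z)"
    have v: "wp w val (\<lambda>t R2 M2. t \<le> tv \<and> M2 = M \<and> (\<forall>r<39. R2 r = ?R r) \<and> R2 39 = F z) ?R M"
      using val[unfolded evaluates_def, rule_format, of ?R] ok fr by simp
    show "i < m * K + 1 \<and> wp w loop
      (\<lambda>t R' M'. t \<le> tv + K * (tv + 9) + tb + 10 \<and> I (Suc i) R' M') R' M'"
    proof (intro conjI iB)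
      show "wp w loop (\<lambda>t R' M'. t \<le> tv + K * (tv + 9) + tb + 10 \<and> I (Suc i) R' M') R' M'"
      unfolding loop_def
      apply (simp add: fr lw envD[OF E])
      apply (rule wp_mono[OF v])
      subgoal for t1 R2 M2
      proof -
        assume a: "t1 \<le> tv \<and> M2 = M \<and> (\<forall>r<39. R2 r = ?R r) \<and> R2 39 = F z"
        then have fr3: "R2 r = ?R r" if "r < 39" for r using that by blast
        have r: "R2 7 = Suc m" "R2 5 = 0" "R2 4 = 1" "R2 (b + 3) = z" "R2 (b + 4) = Z"
          "R2 39 = F z" "R2 0 = R' 0" "M2 = M"
          using a base envD[OF E] fr by (simp_all add: fr3)
        have ok2: "R2 r = R0 r" if "0 < r" "r < b + 3" for r
          using that base ok by (simp add: fr3)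
        define R3 where "R3 = R2(b + 5 := F z, b + 10 := F z * Suc m, b + 6 := z, b + 7 := Z,
          b + 9 := Suc z)"
        have ok3: "R3 r = R0 r" if "0 < r" "r < b + 3" for r
          using that base ok2 by (auto simp: R3_def)
        have r3: "R3 (b + 6) = z" "R3 (b + 7) = Z" "R3 (b + 9) = z + 1" "R3 (b + 10) = F z * (m + 1)"
          "R3 (b + 5) = F z" "R3 (b + 3) = z" "R3 (b + 4) = Z" "R3 0 = R' 0"
          using base r by (simp_all add: R3_def)
        have Fz: "F z * m \<le> R3 (b + 10)" unfolding r3 by simp
        have s: "wp w (search b val) (\<lambda>t R' M'. t \<le> K * (tv + 9) + 2 \<and> M' = M \<and>
          (\<forall>r<b + 6. R' r = R3 r) \<and> z \<le> R' (b + 6) \<and> R' (b + 6) < Z \<and>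
          F (R' (b + 6)) * m \<le> R3 (b + 10) \<and>
          (R' (b + 6) + 1 = Z \<or> R3 (b + 10) < F (R' (b + 6) + 1) * m)) R3 M"
          using ok3 fr by (intro wp_search[OF \<open>env R0\<close> base val F Z(2)] r3 Fz) auto
        have "wp w (search b val) (\<lambda>t. wp w body (\<lambda>u. wp w (Bin Add (b + 3) (b + 6) 4)
          (\<lambda>ua R' M'. t1 + (5 + (t + (u + ua))) \<le> tv + K * (tv + 9) + tb + 9 \<and> I (Suc i) R' M'))) R3 M"
        proof (rule wp_mono[OF s])
          fix t2 R4 M4
          assume s4: "t2 \<le> K * (tv + 9) + 2 \<and> M4 = M \<and>
            (\<forall>r<b + 6. R4 r = R3 r) \<and> z \<le> R4 (b + 6) \<and> R4 (b + 6) < Z \<and>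
            F (R4 (b + 6)) * m \<le> R3 (b + 10) \<and>
            (R4 (b + 6) + 1 = Z \<or> R3 (b + 10) < F (R4 (b + 6) + 1) * m)"
          define lo where "lo = R4 (b + 6)"
          have r4: "R4 r = R3 r" if "r < b + 6" for r using s4 that by blast
          have lo: "z \<le> lo" "lo < Z" "F lo * m \<le> F z * (m + 1)" "M4 = M"
            "lo + 1 = Z \<or> F z * (m + 1) < F (lo + 1) * m"
            using s4 unfolding lo_def r3 by auto
          have ok4: "R4 r = R0 r" if "0 < r" "r < b + 3" for r
            using that r4 ok3 by simp
          have "A \<le> H 1 z" using A(2) by (simp add: approx_def)
          moreover have "H 1 Z = H 1 z + (H z (lo + 1) + H (lo + 1) Z)"
            using H[of 1 z Z] H[of z "lo + 1" Z] fr lo by simp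
          ultimately have U4: "R4 0 + H z (lo + 1) \<le> U"
            using U A(1) r4[of 0] r3 by simp
          have b: "wp w body (\<lambda>t R' M'. t \<le> tb \<and> M' = M \<and>
            (\<forall>r. 0 < r \<longrightarrow> r < b + 11 \<longrightarrow> R' r = R4 r) \<and>
            (\<exists>A. R' 0 = R4 0 + A \<and> approx m A (H z (lo + 1)))) R4 M"
            using ok4 r4 r3 lo fr U4 by (intro body) (auto simp: lo_def)
          have "wp w body (\<lambda>u. wp w (Bin Add (b + 3) (b + 6) 4)
          (\<lambda>ua R' M'. t1 + (5 + (t2 + (u + ua))) \<le> tv + K * (tv + 9) + tb + 9 \<and> I (Suc i) R' M')) R4 M"
          proof (rule wp_mono[OF b])
            fix t3 R5 M5
            assume s5: "t3 \<le> tb \<and> M5 = M \<and>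
              (\<forall>r. 0 < r \<longrightarrow> r < b + 11 \<longrightarrow> R5 r = R4 r) \<and>
              (\<exists>A. R5 0 = R4 0 + A \<and> approx m A (H z (lo + 1)))"
            then obtain A' where A': "R5 0 = R4 0 + A'" "approx m A' (H z (lo + 1))" by blast
            have r5: "R5 r = R4 r" if "0 < r" "r < b + 11" for r using s5 that by blast
            have v5: "R5 (b + 6) = lo" "R5 4 = Suc 0" "R5 (b + 4) = Z" "R5 0 = R0 0 + (A + A')"
              using base r5 r4 r3 A A' ok3[of 4] envD[OF \<open>env R0\<close>] by (simp_all add: lo_def)
            have ok5: "R5 r = R0 r" if "0 < r" "r < b + 3" for r
              using that r5 ok4 by simp
            have "Suc lo < 2 ^ w" using lo Z small_less_word by auto
            have ap: "approx m (A + A') (H 1 (Suc lo))"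
              using approx_add[OF A(2) A'(2)] H[of 1 z "lo + 1"] fr lo by simp
            have p5: "(m + 1) ^ i \<le> F (Suc lo) * m ^ i" if "Suc lo < Z"
            proof (cases "i = 0")
              case True
              \<comment> \<open>Exceeding the threshold makes the value positive even if the first
                interval had value 0; this is the base of the growth estimate.\<close>
              have "F z * (m + 1) < F (Suc lo) * m" using lo that by simp
              then have "0 < F (Suc lo) * m" by linarith
              then show ?thesis using True by simp
            next
              case False
              have "(m + 1) ^ i = (m + 1) * (m + 1) ^ (i - 1)" using False by (cases i) auto
              also have "\<dots> \<le> (m + 1) * (F z * m ^ (i - 1))"
                using pow False by (intro mult_left_mono) auto
              also have "\<dots> = F z * (m + 1) * m ^ (i - 1)" by (simp only: mult_ac)
              also have "\<dots> \<le> F (lo + 1) * m * m ^ (i - 1)"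
                using lo that by (intro mult_right_mono) auto
              also have "\<dots> = F (Suc lo) * m ^ i" using False by (cases i) auto
              finally show ?thesis .
            qed
            show "wp w (Bin Add (b + 3) (b + 6) 4)
              (\<lambda>ua R' M'. t1 + (5 + (t2 + (t3 + ua))) \<le> tv + K * (tv + 9) + tb + 9 \<and>
                I (Suc i) R' M') R5 M5"
              using v5 \<open>Suc lo < 2 ^ w\<close> base lo ap p5 ok5 s5 s4 a
              by (auto simp: I_def)
          qed
          then show "wp w body (\<lambda>u. wp w (Bin Add (b + 3) (b + 6) 4)
          (\<lambda>ua R' M'. t1 + (5 + (t2 + (u + ua))) \<le> tv + K * (tv + 9) + tb + 9 \<and> I (Suc i) R' M')) R4 M4"
            using lo by simp
        qed
        moreover have "wp w (body ;; Bin Add (b + 3) (b + 6) 4) Q =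
          wp w body (\<lambda>t. wp w (Bin Add (b + 3) (b + 6) 4) (\<lambda>u. Q (t + u)))" for Q
          by (intro ext) simp
        ultimately show ?thesis
          using base lw Fm r unfolding R3_def
          by (simp add: add_ac)
      qed
      done
    qed
  next
    fix t R' M'
    assume a: "t \<le> (m * K + 1) * (tv + K * (tv + 9) + tb + 10 + 2) + 2 \<and>
      \<not> R' (b + 3) < R' (b + 4) \<and> (\<exists>i. I i R' M')"
    then obtain i where I: "I i R' M'" by blast
    then have "R' (b + 3) = Z" using a unfolding I_def by auto
    moreover have "t \<le> (m * K + 1) * (tv + K * (tv + 9) + tb + 12) + 2"
      using a by (simp only: add.assoc) simp
    ultimately show "t \<le> (m * K + 1) * (tv + K * (tv + 9) + tb + 12) + 2 \<and> M' = M \<and>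
      (\<forall>r. 0 < r \<longrightarrow> r < b + 3 \<longrightarrow> R' r = R0 r) \<and>
      (\<exists>A. R' 0 = R0 0 + A \<and> approx m A (H 1 Z))"
      using I unfolding I_def by auto
  qed
  have "I 0 (R0(b + 3 := 1)) M"
    using Z H0 approx_0 base unfolding I_def by auto
  then have "wp w (While (b + 3) (b + 4) loop) (\<lambda>t R' M'.
    t \<le> (m * K + 1) * (tv + K * (tv + 9) + tb + 12) + 2 \<and> M' = M \<and>
    (\<forall>r. 0 < r \<longrightarrow> r < b + 3 \<longrightarrow> R' r = R0 r) \<and>
    (\<exists>A. R' 0 = R0 0 + A \<and> approx m A (H 1 Z))) (R0(b + 3 := 1)) M" by (rule main)
  then have "wp w (While (b + 3) (b + 4) loop) (\<lambda>t R' M'. 1 + t \<le> greedy_time tv tb \<and> M' = M \<and>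
    (\<forall>r. 0 < r \<longrightarrow> r < b + 3 \<longrightarrow> R' r = R0 r) \<and>
    (\<exists>A. R' 0 = R0 0 + A \<and> approx m A (H 1 Z))) (R0(b + 3 := 1)) M"
    by (rule wp_mono) (auto simp: greedy_time_def)
  then show ?thesis
    unfolding greedy_def loop_def[symmetric] by (simp add: w_pos)
qed

end

subsection \<open>Copies as weighted inversions\<close>

definition query_at :: "nat \<Rightarrow> nat \<Rightarrow> nat \<Rightarrow> com" where
  "query_at d x y = Bin Add 40 x 5 ;; Bin Add 41 y 5 ;; query ;; Bin Add d 42 5"

definition val_below :: com where
  "val_below = query_at 39 9 18"

text \<open>The argument \<open>u\<close> in register 28 stands for the position
  \<open>n + 1 - u\<close>. The count to the upper right is obtained from one query as
  \<open>below (N - u) (v + 1) + u - (v + 1)\<close>, where \<open>v\<close> is the content of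
  register 10.\<close>

definition val_above :: com where
  "val_above = Bin Sub 40 3 28 ;; Bin Add 41 10 4 ;; query ;; Bin Add 39 42 28 ;; Bin Sub 39 39 41"

text \<open>Inclusion-exclusion with four queries. The two positive counts are summed before the sum
  of the negative ones is subtracted, so no difference wraps around. Registers 15 and 25 hold the
  two factors at the start of the box.\<close>

definition add_cell :: com where
  "add_cell = Bin Sub 31 3 23 ;; Bin Add 32 26 4 ;; Bin Sub 32 3 32 ;; Bin Add 33 16 4 ;;
     query_at 34 31 33 ;; query_at 35 32 13 ;; query_at 36 32 33 ;; query_at 37 31 13 ;;
     Bin Add 34 34 35 ;; Bin Add 36 36 37 ;; Bin Sub 34 34 36 ;;
     Bin Mul 36 15 25 ;; Bin Mul 36 36 34 ;; Bin Add 0 0 36"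

text \<open>Register 24 is the exclusive end of the inner range: in the reversed coordinate, being
  less than \<open>n + 1 - b\<close> means lying to the right of \<open>b\<close>. The outer end is
  expected in register 14.\<close>

definition add_position :: com where
  "add_position = greedy 10 val_below (Bin Sub 24 11 9 ;; greedy 20 val_above add_cell)"

context instance_1324
begin

lemma sum_card: "card {j \<in> {1..n}. P j} = (\<Sum>j\<in>{1..n}. if P j then 1 else 0)"
  by (simp add: sum.If_cases Int_def)

definition above :: "nat \<Rightarrow> nat \<Rightarrow> nat" where
  "above x v = card {j \<in> {1..n}. x < j \<and> v < p j}"

text \<open>Inclusion-exclusion for the complements of the two half-planes \<open>j \<le> x\<close>
  and \<open>p j \<le> v\<close>. They contain \<open>x\<close> and \<open>v\<close> points, the
  latter because \<open>p\<close> is a permutation; so one table serves both directions.\<close>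

lemma above_below:
  assumes "x \<le> n" "v \<le> n"
  shows "below (x + 1) (v + 1) + n = above x v + x + v"
proof -
  have "card {j \<in> {1..n}. p j \<le> v} = card (p ` {j \<in> {1..n}. p j \<le> v})"
    by (rule card_image[symmetric]) (rule inj_on_subset[OF permutes_inj[OF perm]], simp)
  also have "p ` {j \<in> {1..n}. p j \<le> v} = {1..v}"
  proof -
    have "{1..v} \<subseteq> p ` {1..n}" using assms permutes_image[OF perm] by auto
    then show ?thesis using p_range by fastforce
  qed
  finally have "(\<Sum>j\<in>{1..n}. if p j \<le> v then 1 else 0) = v"
    unfolding sum_card by simp
  moreover have "(\<Sum>j\<in>{1..n}. if j \<le> x then 1 else 0) = x"
  proof -
    have "{j \<in> {1..n}. j \<le> x} = {1..x}" using assms by auto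
    then show ?thesis unfolding sum_card[symmetric] by simp
  qed
  moreover have "below (x + 1) (v + 1) + (\<Sum>j\<in>{1..n}. 1) =
    above x v + (\<Sum>j\<in>{1..n}. if j \<le> x then 1 else 0) + (\<Sum>j\<in>{1..n}. if p j \<le> v then 1 else 0)"
    unfolding below_def above_def sum_card sum.distrib[symmetric]
    by (intro sum.cong refl) auto
  ultimately show ?thesis by simp
qed

definition weight :: "nat \<Rightarrow> nat \<Rightarrow> nat" where
  "weight b j = below b (p j) * above j (p b)"

text \<open>
  The horizontal coordinate is \<open>n + 1 - j\<close>, in which the number of points to the upper right
  of \<open>j\<close> is increasing, as \<open>greedy\<close> requires.
\<close>

definition box :: "nat \<Rightarrow> nat \<Rightarrow> nat \<Rightarrow> nat \<Rightarrow> nat \<Rightarrow> bool" where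
  "box y0 y1 x0 x1 j \<longleftrightarrow> y0 \<le> p j \<and> p j < y1 \<and> x0 \<le> n + 1 - j \<and> n + 1 - j < x1"

definition box_sum :: "nat \<Rightarrow> nat \<Rightarrow> nat \<Rightarrow> nat \<Rightarrow> nat \<Rightarrow> nat" where
  "box_sum b y0 y1 x0 x1 = (\<Sum>j\<in>{1..n}. if box y0 y1 x0 x1 j then weight b j else 0)"

lemma box_sum_add_y:
  "y0 \<le> y1 \<Longrightarrow> y1 \<le> y2 \<Longrightarrow> box_sum b y0 y2 x0 x1 = box_sum b y0 y1 x0 x1 + box_sum b y1 y2 x0 x1"
  unfolding box_sum_def sum.distrib[symmetric] by (intro sum.cong) (auto simp: box_def)

lemma box_sum_add_x:
  "x0 \<le> x1 \<Longrightarrow> x1 \<le> x2 \<Longrightarrow> box_sum b y0 y1 x0 x2 = box_sum b y0 y1 x0 x1 + box_sum b y0 y1 x1 x2"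
  unfolding box_sum_def sum.distrib[symmetric] by (intro sum.cong) (auto simp: box_def)

text \<open>Inclusion-exclusion over the corners, stated additively to avoid truncated subtraction.
  The offset 2 comes from reversing a half-open range: \<open>n + 1 - j < x1\<close> amounts to
  \<open>n + 2 - x1 \<le> j\<close>.\<close>

lemma card_box:
  assumes "y0 \<le> y1" "x0 \<le> x1" "x1 \<le> n + 2"
  shows "below (n + 2 - x0) y1 + below (n + 2 - x1) y0 =
    card {j \<in> {1..n}. box y0 y1 x0 x1 j} + below (n + 2 - x1) y1 + below (n + 2 - x0) y0"
  unfolding below_def sum_card sum.distrib[symmetric] using assms
  by (intro sum.cong refl) (auto simp: box_def)

lemma below_mono: "y \<le> y' \<Longrightarrow> below b y \<le> below b y'"
  unfolding below_def by (rule card_mono) auto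

lemma above_mono: "x' \<le> x \<Longrightarrow> above x v \<le> above x' v"
  unfolding above_def by (rule card_mono) auto

lemma below_le: "below b y \<le> n" and above_le: "above x v \<le> n"
  unfolding below_def above_def by (rule card_le_n)+

text \<open>Within the box both factors are smallest at the start, and the hypotheses limit them at
  the last points \<open>yl\<close> and \<open>xl\<close>; by monotonicity each point loses at most
  \<open>1 + 1 / m\<close> per factor.\<close>

lemma approx_box:
  assumes "below b yl * m \<le> below b y0 * (m + 1)"
    and "above (n + 1 - xl) (p b) * m \<le> above (n + 1 - x0) (p b) * (m + 1)"
  shows "approx m (below b y0 * above (n + 1 - x0) (p b) *
      card {j \<in> {1..n}. box y0 (yl + 1) x0 (xl + 1) j})
    (box_sum b y0 (yl + 1) x0 (xl + 1))"
proof -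
  define l r where "l = below b y0" and "r = above (n + 1 - x0) (p b)"
  let ?J = "{j \<in> {1..n}. box y0 (yl + 1) x0 (xl + 1) j}"
  have S: "box_sum b y0 (yl + 1) x0 (xl + 1) = (\<Sum>j\<in>?J. weight b j)"
    unfolding box_sum_def by (simp add: sum.If_cases Int_def)
  have C: "l * r * card ?J = (\<Sum>j\<in>?J. l * r)" by simp
  have *: "l * r \<le> weight b j \<and> m * m * weight b j \<le> (m + 1) * (m + 1) * (l * r)" if "j \<in> ?J" for j
  proof -
    have j: "y0 \<le> p j" "p j \<le> yl" "n + 1 - xl \<le> j" "j \<le> n + 1 - x0"
      using that by (auto simp: box_def)
    have 1: "l \<le> below b (p j)" "r \<le> above j (p b)"
      unfolding l_def r_def using j by (auto intro: below_mono above_mono)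
    have "m * below b (p j) \<le> m * below b yl" by (intro mult_le_mono2 below_mono j)
    also have "\<dots> \<le> (m + 1) * l" using assms(1) by (simp add: l_def mult.commute)
    finally have 2: "m * below b (p j) \<le> (m + 1) * l" .
    have "m * above j (p b) \<le> m * above (n + 1 - xl) (p b)" by (intro mult_le_mono2 above_mono j)
    also have "\<dots> \<le> (m + 1) * r" using assms(2) by (simp add: r_def mult.commute)
    finally have 3: "m * above j (p b) \<le> (m + 1) * r" .
    have "m * m * weight b j = (m * below b (p j)) * (m * above j (p b))"
      unfolding weight_def by (simp only: mult_ac)
    also have "\<dots> \<le> ((m + 1) * l) * ((m + 1) * r)" using 2 3 by (rule mult_le_mono)
    also have "\<dots> = (m + 1) * (m + 1) * (l * r)" by (simp only: mult_ac)
    finally show ?thesis using 1 unfolding weight_def by (auto intro: mult_le_mono)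
  qed
  show ?thesis
    unfolding approx_def l_def[symmetric] r_def[symmetric] S C sum_distrib_left
    by (intro conjI sum_mono) (use * in blast)+
qed

text \<open>Reordering a copy as \<open>(b, c, a, d)\<close> exhibits a dependent product: once the
  middle pair is fixed, \<open>a\<close> and \<open>d\<close> vary independently.\<close>

lemma card_copies: "card (copies_1324 n p) = (\<Sum>b\<in>{1..n}. box_sum b 1 (p b) 1 (n + 1 - b))"
proof -
  define inv where "inv b = {c \<in> {1..n}. b < c \<and> p c < p b}" for b
  define L where "L b c = {j \<in> {1..n}. j < b \<and> p j < p c}" for b c
  define G where "G b c = {j \<in> {1..n}. c < j \<and> p b < p j}" for b c
  define T where "T = (SIGMA b:{1..n}. SIGMA c:inv b. L b c \<times> G b c)"
  have fin: "finite (inv b)" "finite (L b c)" "finite (G b c)" for b c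
    unfolding inv_def L_def G_def by auto
  have "bij_betw (\<lambda>(b, c, a, d). (a, b, c, d)) T (copies_1324 n p)"
    unfolding T_def inv_def L_def G_def copies_1324_def
    by (rule bij_betw_byWitness[where f' = "\<lambda>(a, b, c, d). (b, c, a, d)"]) auto
  then have "card (copies_1324 n p) = card T" by (metis bij_betw_same_card)
  also have "\<dots> = (\<Sum>b\<in>{1..n}. \<Sum>c\<in>inv b. card (L b c) * card (G b c))"
    unfolding T_def using fin by (simp add: card_SigmaI card_cartesian_product)
  also have "\<dots> = (\<Sum>b\<in>{1..n}. box_sum b 1 (p b) 1 (n + 1 - b))"
  proof (rule sum.cong[OF refl])
    fix b assume "b \<in> {1..n}"
    have "(\<Sum>c\<in>inv b. card (L b c) * card (G b c)) = (\<Sum>c\<in>inv b. weight b c)"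
      unfolding L_def G_def weight_def below_def above_def by simp
    also have "\<dots> = (\<Sum>c\<in>{1..n}. if b < c \<and> p c < p b then weight b c else 0)"
      unfolding inv_def by (simp add: sum.If_cases Int_def)
    also have "\<dots> = box_sum b 1 (p b) 1 (n + 1 - b)"
      unfolding box_sum_def
    proof (intro sum.cong refl)
      fix c assume "c \<in> {1..n}"
      then show "(if b < c \<and> p c < p b then weight b c else 0) =
        (if box 1 (p b) 1 (n + 1 - b) c then weight b c else 0)"
        using p_range[of c] \<open>b \<in> {1..n}\<close> by (auto simp: box_def)
    qed
    finally show "(\<Sum>c\<in>inv b. card (L b c) * card (G b c)) = box_sum b 1 (p b) 1 (n + 1 - b)" .
  qed
  finally show ?thesis .
qed

lemma copies_le: "card (copies_1324 n p) \<le> n ^ 4"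
proof -
  have "copies_1324 n p \<subseteq> {1..n} \<times> {1..n} \<times> {1..n} \<times> {1..n}"
    unfolding copies_1324_def by auto
  then have "card (copies_1324 n p) \<le> card ({1..n} \<times> {1..n} \<times> {1..n} \<times> {1..n})"
    by (intro card_mono) auto
  then show ?thesis by (simp add: card_cartesian_product eval_nat_numeral)
qed

lemma wp_query_at:
  assumes "env R" "table M" "R x < N" "R y < N" "x < 40" "y < 40"
    and "\<And>t R'. t \<le> query_time + 3 \<Longrightarrow> (\<forall>r<40. r \<noteq> d \<longrightarrow> R' r = R r) \<Longrightarrow>
      R' d = below (R x) (R y) \<Longrightarrow> Q t R' M"
  shows "wp w (query_at d x y) Q R M"
proof -
  have lw: "R x < 2 ^ w" "R y < 2 ^ w" "below (R x) (R y) < 2 ^ w"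
    using assms below_le[of "R x" "R y"] N_ge small_less_word by auto
  let ?R = "R(40 := R x, 41 := R y)"
  have "wp w query (\<lambda>t R' M'. t \<le> query_time \<and> M' = M \<and>
    (\<forall>r<42. R' r = ?R r) \<and> R' 42 = below (?R 40) (?R 41)) ?R M"
    using assms by (intro wp_query) (auto simp: env_def)
  then have "wp w query (\<lambda>t. wp w (Bin Add d 42 5) (\<lambda>u. Q (1 + (1 + (t + u))))) ?R M"
  proof (rule wp_mono)
    fix t R' M'
    assume a: "t \<le> query_time \<and> M' = M \<and> (\<forall>r<42. R' r = ?R r) \<and> R' 42 = below (?R 40) (?R 41)"
    then have "\<And>r. r < 42 \<Longrightarrow> R' r = ?R r" by blast
    then show "wp w (Bin Add d 42 5) (\<lambda>u. Q (1 + (1 + (t + u)))) R' M'"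
      using a lw envD[OF assms(1)] by (simp add: assms(7))
  qed
  then show ?thesis
    using assms lw envD[OF assms(1)] unfolding query_at_def by simp
qed

end

subsection \<open>Summing over boxes\<close>

context instance_1324
begin

lemma N_sub_mod: "x \<le> N \<Longrightarrow> (N + 2 ^ w - x) mod 2 ^ w = N - x"
  using sub_mod[of x N "2 ^ w"] small_less_word[of N] by simp

lemma evaluates_below:
  assumes "env R0" "table M" "R0 9 < N" "Z \<le> N"
  shows "evaluates val_below (query_time + 3) (below (R0 9)) 10 Z R0 M"
  unfolding evaluates_def val_below_def
proof (intro allI impI)
  fix R :: store
  assume a: "\<forall>r. 0 < r \<longrightarrow> r < 10 + 3 \<longrightarrow> R r = R0 r" "1 \<le> R (10 + 8)" "R (10 + 8) < Z"
  have E: "env R" using assms(1) by (rule env_cong) (use a in auto)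
  have "R 9 = R0 9" using a by simp
  then show "wp w (query_at 39 9 18) (\<lambda>t R' M'. t \<le> query_time + 3 \<and> M' = M \<and> (\<forall>r<39. R' r = R r) \<and>
      R' 39 = below (R0 9) (R (10 + 8))) R M"
    using assms a by (intro wp_query_at E) auto
qed

lemma evaluates_above:
  assumes "env R0" "table M" "R0 10 = v" "1 \<le> v" "v \<le> n" "Z \<le> n + 1"
  shows "evaluates val_above (query_time + 5) (\<lambda>u. above (n + 1 - u) v) 20 Z R0 M"
  unfolding evaluates_def
proof (intro allI impI)
  fix R :: store
  assume a: "\<forall>r. 0 < r \<longrightarrow> r < 20 + 3 \<longrightarrow> R r = R0 r" "1 \<le> R (20 + 8)" "R (20 + 8) < Z"
  define u where "u = R 28"
  have u: "1 \<le> u" "u \<le> n" using a assms unfolding u_def by auto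
  have E: "env R" using assms(1) by (rule env_cong) (use a in auto)
  have v: "R 10 = v" using a assms by simp
  let ?R = "R(40 := N - u, 41 := Suc v)"
  \<comment> \<open>With \<open>x = n + 1 - u\<close>, the bound \<open>x + 1\<close> is
    \<open>N - u\<close>.\<close>
  have "below (N - u) (Suc v) + n = above (n + 1 - u) v + (n + 1 - u) + v"
    using above_below[of "n + 1 - u" v] u assms by (simp add: N_def Suc_diff_le)
  then have ident: "below (N - u) (Suc v) + u = above (n + 1 - u) v + Suc v"
    using u by simp
  have lw: "Suc v < 2 ^ w" "N < 2 ^ w" "below (N - u) (Suc v) + u < 2 ^ w"
    using assms u below_le[of "N - u" "Suc v"] N_ge small_less_word by auto
  have sub: "(below (N - u) (Suc v) + u + 2 ^ w - Suc v) mod 2 ^ w = above (n + 1 - u) v"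
    using sub_mod[of "Suc v" "below (N - u) (Suc v) + u" "2 ^ w"] lw ident by simp
  have "wp w query (\<lambda>t R' M'. t \<le> query_time \<and> M' = M \<and>
    (\<forall>r<42. R' r = ?R r) \<and> R' 42 = below (?R 40) (?R 41)) ?R M"
    using assms u E by (intro wp_query) (auto simp: env_def N_def)
  then have "wp w query (\<lambda>t. wp w (Bin Add 39 42 28 ;; Bin Sub 39 39 41)
    (\<lambda>ua R' M'. 1 + (1 + (t + ua)) \<le> query_time + 5 \<and> M' = M \<and> (\<forall>r<39. R' r = R r) \<and>
      R' 39 = above (n + 1 - u) v)) ?R M"
  proof (rule wp_mono)
    fix t R' M'
    assume q: "t \<le> query_time \<and> M' = M \<and> (\<forall>r<42. R' r = ?R r) \<and> R' 42 = below (?R 40) (?R 41)"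
    then have "\<And>r. r < 42 \<Longrightarrow> R' r = ?R r" by blast
    then show "wp w (Bin Add 39 42 28 ;; Bin Sub 39 39 41)
      (\<lambda>ua R' M'. 1 + (1 + (t + ua)) \<le> query_time + 5 \<and> M' = M \<and> (\<forall>r<39. R' r = R r) \<and>
      R' 39 = above (n + 1 - u) v) R' M'"
      using q lw sub by (simp add: u_def[symmetric])
  qed
  moreover have "wp w (Bin Add 39 42 28 ;; Bin Sub 39 39 41) Q =
          wp w (Bin Add 39 42 28) (\<lambda>t. wp w (Bin Sub 39 39 41) (\<lambda>u. Q (t + u)))" for Q
          by (intro ext) simp
  ultimately show "wp w val_above (\<lambda>t R' M'. t \<le> query_time + 5 \<and> M' = M \<and> (\<forall>r<39. R' r = R r) \<and>
      R' 39 = above (n + 1 - R (20 + 8)) v) R M"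
    using u lw envD[OF E] v N_ge unfolding val_above_def by (simp add: u_def[symmetric] N_sub_mod)
qed

lemma wp_add_cell:
  assumes "env R" "table M" and y: "R 13 = y0" "R 16 = y1" "y0 \<le> y1" "y1 \<le> n"
    and x: "R 23 = x0" "R 26 = x1" "1 \<le> x0" "x0 \<le> x1" "x1 \<le> n"
    and lr: "R 15 = l" "R 25 = r" "l \<le> n" "r \<le> n"
    and U: "R 0 + l * r * card {j \<in> {1..n}. box y0 (y1 + 1) x0 (x1 + 1) j} \<le> n ^ 4"
  shows "wp w add_cell (\<lambda>t R' M'. t \<le> 4 * query_time + 22 \<and> M' = M \<and>
    (\<forall>r. 0 < r \<longrightarrow> r < 31 \<longrightarrow> R' r = R r) \<and>
    R' 0 = R 0 + l * r * card {j \<in> {1..n}. box y0 (y1 + 1) x0 (x1 + 1) j}) R M"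
proof -
  define c where "c = card {j \<in> {1..n}. box y0 (y1 + 1) x0 (x1 + 1) j}"
  define xa xb y where "xa = N - x0" and "xb = N - Suc x1" and "y = Suc y1"
  have "Suc n < N" by (simp add: N_def)
  then have lt: "xa < N" "xb < N" "y < N" "y0 < N" "Suc x1 \<le> N" "x0 \<le> N" "Suc x1 < 2 ^ w" "Suc y1 < 2 ^ w"
    using x y N_ge \<open>Suc n < N\<close> small_less_word by (auto simp: xa_def xb_def y_def)
  define q1 q2 q3 q4 where "q1 = below xa y" and "q2 = below xb y0" and "q3 = below xb y"
    and "q4 = below xa y0"
  have incl: "q1 + q2 = c + (q3 + q4)"
    using card_box[of y0 "y1 + 1" x0 "x1 + 1"] x y
    unfolding q1_def q2_def q3_def q4_def c_def xa_def xb_def y_def by (simp add: N_def)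
  have "q1 \<le> n" "q2 \<le> n" "q3 \<le> n" "q4 \<le> n" unfolding q1_def q2_def q3_def q4_def by (rule below_le)+
  then have qw: "q1 + q2 < 2 ^ w" "q3 + q4 < 2 ^ w" using N_ge small_less_word by auto
  have "c \<le> n" unfolding c_def by (rule card_le_n)
  have sub: "(q1 + q2 + 2 ^ w - (q3 + q4)) mod 2 ^ w = c"
    using sub_mod[of "q3 + q4" "q1 + q2" "2 ^ w"] incl qw by simp
  have "l * r \<le> n * n" using lr by (intro mult_le_mono)
  also have "\<dots> < N * N" using N_ge by (intro mult_strict_mono) auto
  finally have lrw: "l * r < 2 ^ w" using pow_less_word[of "l * r" 2] by (simp add: power2_eq_square)
  have "n ^ 4 < N ^ 4" using N_ge by (intro power_strict_mono) auto
  then have nw: "n ^ 4 < 2 ^ w" using pow_less_word[of "n ^ 4" 4] by simp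
  then have Uw: "R 0 + l * r * c < 2 ^ w" "l * r * c < 2 ^ w" using U unfolding c_def by auto
  note e = envD[OF assms(1)]
  have s1: "(N + 2 ^ w - x0) mod 2 ^ w = xa" "(N + 2 ^ w - Suc x1) mod 2 ^ w = xb"
    "(N + (2 ^ w - x0)) mod 2 ^ w = xa" "(N + (2 ^ w - Suc x1)) mod 2 ^ w = xb"
    using N_sub_mod lt sub_mod[of _ N "2 ^ w"] small_less_word[of N] unfolding xa_def xb_def by auto
  have env: "env R'" if "\<And>r. 0 < r \<Longrightarrow> r < 31 \<Longrightarrow> R' r = R r" for R'
    using assms(1) by (rule env_cong) (use that in auto)
  show ?thesis
    unfolding add_cell_def c_def[symmetric]
    apply (simp add: e x y s1 lt)
    apply (rule wp_query_at)
    subgoal by (rule env) simp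
    subgoal by fact
    subgoal using lt by simp
    subgoal using lt by (simp add: y_def)
    subgoal by simp
    subgoal by simp
    subgoal premises p1 for t1 R1
      apply simp
      apply (rule wp_query_at)
      subgoal by (rule env) (use p1(2) in simp)
      subgoal by fact
      subgoal using p1(2) lt by simp
      subgoal using p1(2) lt y by simp
      subgoal by simp
      subgoal by simp
      subgoal premises p2 for t2 R2
        apply simp
        apply (rule wp_query_at)
        subgoal by (rule env) (use p1(2) p2(2) in simp)
        subgoal by fact
        subgoal using p1(2) p2(2) lt by simp
        subgoal using p1(2) p2(2) lt y by (simp add: y_def)
        subgoal by simp
        subgoal by simp
        subgoal premises p3 for t3 R3
          apply simp
          apply (rule wp_query_at)
          subgoal by (rule env) (use p1(2) p2(2) p3(2) in simp)
          subgoal by fact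
          subgoal using p1(2) p2(2) p3(2) lt by simp
          subgoal using p1(2) p2(2) p3(2) lt y by simp
          subgoal by simp
          subgoal by simp
          subgoal premises p4 for t4 R4
          proof -
            have v: "R4 34 = q1" "R4 35 = q2" "R4 36 = q3" "R4 37 = q4"
              "R4 15 = l" "R4 25 = r" "R4 0 = R 0"
              using p1(2,3) p2(2,3) p3(2,3) p4(2,3) y lr
              by (simp_all add: q1_def q2_def q3_def q4_def y_def)
            have f: "R4 r = R r" if "r < 31" for r
              using p1(2) p2(2) p3(2) p4(2) that by simp
            show ?thesis
              using p1(1) p2(1) p3(1) p4(1) v f qw sub lrw Uw by simp
          qed
          done
        done
      done
    done
qed

definition position_time :: nat where
  "position_time = greedy_time (query_time + 3) (greedy_time (query_time + 5) (4 * query_time + 22) + 1)"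

lemma wp_add_position:
  assumes "1 \<le> m" "env R0" "table M" "b \<in> {1..n}"
    and R0: "R0 9 = b" "R0 10 = p b" "R0 11 = n + 1" "R0 14 = p b"
    and U: "R0 0 + box_sum b 1 (p b) 1 (n + 1 - b) \<le> n ^ 4"
  shows "wp w add_position (\<lambda>t R' M'. t \<le> position_time \<and> M' = M \<and>
    (\<forall>r. 0 < r \<longrightarrow> r < 10 + 3 \<longrightarrow> R' r = R0 r) \<and>
    (\<exists>A. R' 0 = R0 0 + A \<and> approx m A (box_sum b 1 (p b) 1 (n + 1 - b)))) R0 M"
  unfolding add_position_def position_time_def
proof (rule wp_greedy[where F = "below b" and Z = "p b" and U = "n ^ 4" and
      H = "\<lambda>x z. box_sum b x z 1 (n + 1 - b)"])
  have b: "1 \<le> b" "b \<le> n" "1 \<le> p b" "p b \<le> n" using assms p_range[of b] by auto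
  show "1 \<le> m" "env R0" by fact+
  show "evaluates val_below (query_time + 3) (below b) 10 (p b) R0 M"
    using evaluates_below[of R0 M "p b"] assms b N_ge by simp
  show "R0 0 + box_sum b 1 (p b) 1 (n + 1 - b) \<le> n ^ 4" by fact
  show "1 \<le> p b" "p b \<le> N" "R0 (10 + 4) = p b" using b N_ge assms by auto
  show "(9::nat) \<le> 10" "(10::nat) + 10 < 39" by auto
  show "below b x \<le> n" for x by (rule below_le)
  show "below b x \<le> below b y" if "x \<le> y" for x y using that by (rule below_mono)
  show "box_sum b x z 1 (n + 1 - b) = box_sum b x y 1 (n + 1 - b) + box_sum b y z 1 (n + 1 - b)"
    if "x \<le> y" "y \<le> z" for x y z using that by (rule box_sum_add_y)
next
  fix R z lo
  have b: "1 \<le> b" "b \<le> n" "1 \<le> p b" "p b \<le> n" using assms p_range[of b] by auto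
  assume ok: "\<forall>r. 0 < r \<longrightarrow> r < 10 + 3 \<longrightarrow> R r = R0 r" and R: "R (10 + 3) = z" "R (10 + 6) = lo"
    "R (10 + 5) = below b z" and z: "1 \<le> z" "z \<le> lo" "lo < p b"
    and ratio: "below b lo * m \<le> below b z * (m + 1)"
    and U': "R 0 + box_sum b z (lo + 1) 1 (n + 1 - b) \<le> n ^ 4"
  define R1 where "R1 = R(24 := n + 1 - b)"
  have E: "env R1" using assms(2) by (rule env_cong) (use ok in \<open>simp add: R1_def\<close>)
  have "wp w (greedy 20 val_above add_cell)
    (\<lambda>t R' M'. t \<le> greedy_time (query_time + 5) (4 * query_time + 22) \<and> M' = M \<and>
      (\<forall>r. 0 < r \<longrightarrow> r < 20 + 3 \<longrightarrow> R' r = R1 r) \<and>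
      (\<exists>A. R' 0 = R1 0 + A \<and> approx m A (box_sum b z (lo + 1) 1 (n + 1 - b)))) R1 M"
  proof (rule wp_greedy[where F = "\<lambda>u. above (n + 1 - u) (p b)" and Z = "n + 1 - b" and
        U = "n ^ 4" and H = "\<lambda>x y. box_sum b z (lo + 1) x y"])
    show "1 \<le> m" "env R1" by fact+
    show "evaluates val_above (query_time + 5) (\<lambda>u. above (n + 1 - u) (p b)) 20 (n + 1 - b) R1 M"
      using assms b ok by (intro evaluates_above E) (auto simp: R1_def)
    show "R1 0 + box_sum b z (lo + 1) 1 (n + 1 - b) \<le> n ^ 4" using U' by (simp add: R1_def)
    show "1 \<le> n + 1 - b" "n + 1 - b \<le> N" "R1 (20 + 4) = n + 1 - b"
      using b N_ge by (auto simp: R1_def)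
    show "(9::nat) \<le> 20" "(20::nat) + 10 < 39" by auto
    show "above (n + 1 - x) (p b) \<le> n" for x by (rule above_le)
    show "above (n + 1 - x) (p b) \<le> above (n + 1 - y) (p b)" if "x \<le> y" for x y
      using that by (intro above_mono) simp
    show "box_sum b z (lo + 1) x x2 = box_sum b z (lo + 1) x x1 + box_sum b z (lo + 1) x1 x2"
      if "x \<le> x1" "x1 \<le> x2" for x x1 x2 using that by (rule box_sum_add_x)
  next
    fix R2 x0 x1
    assume ok2: "\<forall>r. 0 < r \<longrightarrow> r < 20 + 3 \<longrightarrow> R2 r = R1 r" and R2: "R2 (20 + 3) = x0"
      "R2 (20 + 6) = x1" "R2 (20 + 5) = above (n + 1 - x0) (p b)"
      and x: "1 \<le> x0" "x0 \<le> x1" "x1 < n + 1 - b"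
      and ratio2: "above (n + 1 - x1) (p b) * m \<le> above (n + 1 - x0) (p b) * (m + 1)"
      and U2: "R2 0 + box_sum b z (lo + 1) x0 (x1 + 1) \<le> n ^ 4"
    define A where "A = below b z * above (n + 1 - x0) (p b) *
      card {j \<in> {1..n}. box z (lo + 1) x0 (x1 + 1) j}"
    have ap: "approx m A (box_sum b z (lo + 1) x0 (x1 + 1))"
      unfolding A_def using ratio ratio2 by (rule approx_box)
    have E2: "env R2" using E by (rule env_cong) (use ok2 in simp)
    have "R2 0 + A \<le> n ^ 4" using ap U2 by (simp add: approx_def)
    then have "wp w add_cell (\<lambda>t R' M'. t \<le> 4 * query_time + 22 \<and> M' = M \<and>
      (\<forall>r. 0 < r \<longrightarrow> r < 31 \<longrightarrow> R' r = R2 r) \<and> R' 0 = R2 0 + A) R2 M"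
      unfolding A_def using ok2 R R2 x z b assms(3)
      by (intro wp_add_cell E2) (auto simp: R1_def below_le above_le)
    then show "wp w add_cell (\<lambda>t R' M'. t \<le> 4 * query_time + 22 \<and> M' = M \<and>
      (\<forall>r. 0 < r \<longrightarrow> r < 20 + 11 \<longrightarrow> R' r = R2 r) \<and>
      (\<exists>A. R' 0 = R2 0 + A \<and> approx m A (box_sum b z (lo + 1) x0 (x1 + 1)))) R2 M"
      by (rule wp_mono) (use ap in auto)
  qed
  then have "wp w (greedy 20 val_above add_cell)
    (\<lambda>t R' M'. 1 + t \<le> greedy_time (query_time + 5) (4 * query_time + 22) + 1 \<and> M' = M \<and>
      (\<forall>r. 0 < r \<longrightarrow> r < 10 + 11 \<longrightarrow> R' r = R r) \<and>
      (\<exists>A. R' 0 = R 0 + A \<and> approx m A (box_sum b z (lo + 1) 1 (n + 1 - b)))) R1 M"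
    by (rule wp_mono) (auto simp: R1_def)
  moreover have sm: "Suc (n + 2 ^ w - b) mod 2 ^ w = Suc n - b"
  proof -
    have lt: "b < 2 ^ w" "n + 1 < 2 ^ w" using b N_ge small_less_word by auto
    then have "Suc (n + 2 ^ w - b) = n + 1 + (2 ^ w - b)" by linarith
    moreover have "(n + 1 + (2 ^ w - b)) mod 2 ^ w = n + 1 - b" using b lt by (intro sub_mod) auto
    ultimately show ?thesis by (metis Suc_eq_plus1)
  qed
  ultimately show "wp w (Bin Sub 24 11 9 ;; greedy 20 val_above add_cell)
    (\<lambda>t R' M'. t \<le> greedy_time (query_time + 5) (4 * query_time + 22) + 1 \<and> M' = M \<and>
      (\<forall>r. 0 < r \<longrightarrow> r < 10 + 11 \<longrightarrow> R' r = R r) \<and>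
      (\<exists>A. R' 0 = R 0 + A \<and> approx m A (box_sum b z (lo + 1) 1 (n + 1 - b)))) R M"
    using ok R0 b small_less_word[of b] N_ge by (simp add: R1_def sm)
qed

end

section \<open>Summation over all positions\<close>

definition add_all :: com where
  "add_all = Set 9 1 ;; Bin Add 11 2 4 ;;
     While 9 11 (Get 10 9 ;; Bin Add 14 10 5 ;; add_position ;; Bin Add 9 9 4)"

context instance_1324
begin

lemma wp_add_all:
  assumes "1 \<le> m" "env R" "table M" "R 0 = 0"
  shows "wp w add_all (\<lambda>t R' M'. t \<le> n * (position_time + 5) + 4 \<and>
    approx m (R' 0) (card (copies_1324 n p))) R M"
proof -
  define X where "X b = box_sum b 1 (p b) 1 (n + 1 - b)" for b
  define I where "I i R' M' \<longleftrightarrow> i \<le> n \<and> M' = M \<and> (\<forall>r. 0 < r \<longrightarrow> r < 9 \<longrightarrow> R' r = R r) \<and>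
    R' 9 = i + 1 \<and> R' 11 = n + 1 \<and> approx m (R' 0) (\<Sum>b\<in>{1..i}. X b)"
    for i and R' M' :: store
  define body where "body = (Get 10 9 ;; Bin Add 14 10 5 ;; add_position ;; Bin Add 9 9 4)"
  have loop: "wp w (While 9 11 body)
     (\<lambda>t R' M'. 1 + (1 + t) \<le> n * (position_time + 5) + 4 \<and> approx m (R' 0) (card (copies_1324 n p))) R1 M"
    if "I 0 R1 M" for R1
  proof (rule wp_mono[OF wp_while[where I = I and B = n and T = "position_time + 3"]])
    show "I 0 R1 M" by fact
  next
    fix i R' M'
    assume I: "I i R' M'" and less: "R' 9 < R' 11"
    have E: "env R'"
      using assms(2) by (rule env_cong) (use I in \<open>auto simp: I_def\<close>)
    have ik: "i < n" using less I unfolding I_def by simp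
    have fr: "R' 9 = Suc i" "R' 11 = n + 1" "M' = M" "approx m (R' 0) (\<Sum>b\<in>{1..i}. X b)"
      and fr2: "\<And>r. 0 < r \<Longrightarrow> r < 9 \<Longrightarrow> R' r = R r"
      using I unfolding I_def by auto
    have bi: "Suc i \<in> {1..n}" using ik by auto
    have Mi: "M (Suc i) = p (Suc i)" using assms(3) bi unfolding table_def by blast
    have pw: "p (Suc i) < 2 ^ w" "Suc (Suc i) < 2 ^ w"
      using p_range[OF bi] bi N_ge small_less_word by auto
    define R2 where "R2 = R'(10 := p (Suc i), 14 := p (Suc i))"
    \<comment> \<open>The accumulator underestimates the finished terms, so adding the exact next
      term still gives at most the total count, hence at most \<open>n ^ 4\<close>.\<close>
    have "R' 0 + X (Suc i) \<le> (\<Sum>b\<in>{1..Suc i}. X b)" using fr(4) by (simp add: approx_def)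
    also have "\<dots> \<le> (\<Sum>b\<in>{1..n}. X b)" using ik by (intro sum_mono2) auto
    also have "\<dots> \<le> n ^ 4" using copies_le unfolding card_copies X_def .
    finally have U: "R2 0 + X (Suc i) \<le> n ^ 4" unfolding R2_def by simp
    have "env R2" using E by (rule env_cong) (simp add: R2_def)
    then have "wp w add_position (\<lambda>t R' M'. t \<le> position_time \<and> M' = M \<and>
      (\<forall>r. 0 < r \<longrightarrow> r < 10 + 3 \<longrightarrow> R' r = R2 r) \<and>
      (\<exists>A. R' 0 = R2 0 + A \<and> approx m A (X (Suc i)))) R2 M"
      using U fr unfolding X_def
      by (intro wp_add_position[OF assms(1) \<open>env R2\<close> assms(3) bi]) (auto simp: R2_def)
    then have "wp w add_position (\<lambda>t. wp w (Bin Add 9 9 4)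
      (\<lambda>u R' M'. 1 + (1 + (t + u)) \<le> position_time + 3 \<and> I (Suc i) R' M')) R2 M"
    proof (rule wp_mono)
      fix t R3 M3
      assume a: "t \<le> position_time \<and> M3 = M \<and> (\<forall>r. 0 < r \<longrightarrow> r < 10 + 3 \<longrightarrow> R3 r = R2 r) \<and>
        (\<exists>A. R3 0 = R2 0 + A \<and> approx m A (X (Suc i)))"
      then obtain A where A: "R3 0 = R' 0 + A" "approx m A (X (Suc i))" by (auto simp: R2_def)
      have f3: "\<And>r. 0 < r \<Longrightarrow> r < 13 \<Longrightarrow> R3 r = R2 r" using a by auto
      show "wp w (Bin Add 9 9 4)
        (\<lambda>u R' M'. 1 + (1 + (t + u)) \<le> position_time + 3 \<and> I (Suc i) R' M') R3 M3"
        using a f3 ik pw fr A approx_add[OF fr(4) A(2)] envD[OF E] fr2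
        by (simp add: I_def R2_def)
    qed
    then show "i < n \<and> wp w body (\<lambda>t R' M'. t \<le> position_time + 3 \<and> I (Suc i) R' M') R' M'"
      unfolding body_def using ik pw fr Mi envD[OF E] by (simp add: R2_def)
  next
    fix t R' M'
    assume a: "t \<le> n * (position_time + 3 + 2) + 2 \<and> \<not> R' 9 < R' 11 \<and> (\<exists>i. I i R' M')"
    then obtain i where I: "I i R' M'" by blast
    then have "i = n" using a unfolding I_def by simp
    with I have "approx m (R' 0) (card (copies_1324 n p))"
      unfolding I_def card_copies X_def by simp
    moreover have "1 + (1 + t) \<le> n * (position_time + 5) + 4" using a by (simp add: add.commute)
    ultimately show "1 + (1 + t) \<le> n * (position_time + 5) + 4 \<and> approx m (R' 0) (card (copies_1324 n p))"
      by blast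
  qed
  have "I 0 (R(9 := Suc 0, 11 := Suc n)) M"
    using assms approx_0 by (auto simp: I_def)
  moreover have "Suc n < 2 ^ w" using small_less_word N_ge by auto
  ultimately show ?thesis
    unfolding add_all_def body_def[symmetric] using envD[OF assms(2)] w_pos loop by simp
qed

end

subsection \<open>Precision and running time\<close>

text \<open>
  Since \<open>2 ^ w\<close> is not a word, the largest word \<open>0 - 1\<close> is divided instead, and rounding down is
  compensated by adding \<open>1\<close>.  The quotient is capped at \<open>n ^ 4\<close>: this prevents overflow, and from there
  on the error is below \<open>1\<close>, so that the answer is exact.
\<close>

definition prologue :: com where
  "prologue = Bin Add 2 0 5 ;; Set 4 1 ;; Set 6 2 ;; Bin Add 3 2 6 ;; Bin Sub 9 5 4 ;;
     Cond 1 4 (Bin Add 1 4 5) (Set 5 0) ;; Bin Div 9 9 1 ;;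
     Bin Mul 10 2 2 ;; Bin Mul 10 10 10 ;; Cond 10 9 (Bin Add 9 10 5) (Set 5 0) ;;
     Bin Add 9 9 4 ;; Bin Mul 8 9 6 ;; Bin Add 7 8 4 ;; Bin Add 0 5 5"

text \<open>The factor 2 pays for the two factors of a weight, each off by up to
  \<open>1 + 1 / m\<close>. \<open>max e 1\<close> handles an \<open>eps\<close> so small that its
  truncation is 0.\<close>

definition precision :: "nat \<Rightarrow> nat \<Rightarrow> nat \<Rightarrow> nat" where
  "precision n w e = 2 * (min (n ^ 4) ((2 ^ w - 1) div max e 1) + 1)"

lemma precision_le:
  assumes "n \<ge> 1"
  shows "precision n w e + 1 \<le> (n + 2) ^ 5"
proof -
  have "n ^ 4 \<le> (n + 2) ^ 4" "1 \<le> (n + 2) ^ 4" by (auto intro: power_mono)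
  moreover have "min (n ^ 4) ((2 ^ w - 1) div max e 1) \<le> n ^ 4" by simp
  ultimately have "precision n w e + 1 \<le> 2 * (n + 2) ^ 4 + 3"
    unfolding precision_def by (simp only: distrib_left)
  also have "\<dots> \<le> 3 * (n + 2) ^ 4"
    using power_mono[of 3 "n + 2" 4] assms by simp
  also have "\<dots> \<le> (n + 2) * (n + 2) ^ 4" using assms by (intro mult_right_mono) auto
  also have "\<dots> = (n + 2) ^ 5" by (simp only: eval_nat_numeral power_Suc)
  finally show ?thesis .
qed

lemma wp_prologue:
  assumes "n \<ge> 1" "(n + 2) ^ 8 \<le> 2 ^ w" "R 0 = n" "R 1 = e" "\<And>r. 2 \<le> r \<Longrightarrow> R r = 0"
  shows "wp w prologue (\<lambda>t R' M'. t \<le> 18 \<and> M' = M \<and> R' 0 = 0 \<and> R' 2 = n \<and> R' 3 = n + 2 \<and>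
    R' 4 = 1 \<and> R' 5 = 0 \<and> R' 6 = 2 \<and> R' 7 = precision n w e + 1 \<and> R' 8 = precision n w e) R M"
proof -
  have big: "(n + 2) ^ 5 < 2 ^ w"
  proof -
    have "(n + 2) ^ 5 < (n + 2) ^ 8" by (intro power_strict_increasing) auto
    with assms show ?thesis by linarith
  qed
  have "n + 2 \<le> (n + 2) ^ 5" by (rule self_le_power) auto
  then have n2: "n + 2 < 2 ^ w" using big by linarith
  have "w \<noteq> 0" using n2 by (cases w) auto
  then have w: "0 < w" "2 < (2::nat) ^ w" using n2 assms(1) by auto
  have "n ^ 4 \<le> (n + 2) ^ 4" "n * n \<le> (n + 2) ^ 2"
    by (auto intro: power_mono mult_le_mono simp: power2_eq_square)
  moreover have "(n + 2) ^ 4 \<le> (n + 2) ^ 5" "(n + 2) ^ 2 \<le> (n + 2) ^ 5" by (auto intro!: power_increasing)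
  ultimately have n4: "n ^ 4 < 2 ^ w" "n * n < 2 ^ w" using big by linarith+
  have n4': "n * n * (n * n) = n ^ 4" by (simp add: eval_nat_numeral)
  define q where "q = (2 ^ w - Suc 0) div max e 1"
  define q' where "q' = min (n ^ 4) q"
  have p: "precision n w e = Suc (Suc (q' * 2))" unfolding precision_def q'_def q_def by simp
  have q'n: "2 * (q' + 1) + 1 < 2 ^ w"
    using precision_le[OF assms(1), of w e] big unfolding p by simp
  have q'w: "Suc q' < 2 ^ w" "q' * 2 < 2 ^ w" "Suc (Suc (Suc (q' * 2))) < 2 ^ w" "Suc (Suc (q' * 2)) < 2 ^ w"
    using q'n by auto
  have qw: "q < 2 ^ w" unfolding q_def
    by (rule le_less_trans[OF div_le_dividend]) simp
  have nw: "n < 2 ^ w" "Suc (Suc n) < 2 ^ w" using n2 by auto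
  show ?thesis
  proof (cases "n ^ 4 < q")
    case True
    then have qq: "q' = n ^ 4" by (simp add: q'_def)
    show ?thesis
    proof (cases "e = 0")
      case True
      then have dq: "2 ^ w - Suc 0 = q" by (simp add: q_def)
      show ?thesis
        using True assms(3-5) w n4 nw qw q'w \<open>n ^ 4 < q\<close>
        unfolding prologue_def p qq by (simp add: dq n4')
    next
      case False
      then have dq: "(2 ^ w - Suc 0) div e = q" by (simp add: q_def max_absorb1)
      show ?thesis
        using False assms(3-5) w n4 nw qw q'w \<open>n ^ 4 < q\<close>
        unfolding prologue_def p qq by (simp add: dq n4')
    qed
  next
    case False
    then have qq: "q' = q" by (simp add: q'_def)
    \<comment> \<open>For \<open>e = 0\<close> the quotient would be the largest word, which is
      above the cap.\<close>
    have "e \<noteq> 0"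
    proof
      assume "e = 0"
      then have "q + 1 = 2 ^ w" by (simp add: q_def)
      then show False using q'n qq by simp
    qed
    then have dq: "(2 ^ w - Suc 0) div e = q" by (simp add: q_def max_absorb1)
    show ?thesis
      using False \<open>e \<noteq> 0\<close> assms(3-5) w n4 nw qw q'w[unfolded qq]
      unfolding prologue_def p qq by (simp add: dq n4')
  qed
qed

definition count_copies :: com where
  "count_copies = prologue ;; fill_table ;; add_all"

text \<open>With \<open>k = m + 1\<close>, the inequality
  \<open>(1 - 1 / k)\<^sup>2 \<ge> 1 - 2 / k\<close> bounds the relative error by
  \<open>2 / k\<close>. Either this is at most \<open>eps\<close>, or the absolute error is below 1
  and therefore 0, as both numbers are integers.\<close>

lemma approx_approximation:
  fixes eps :: real
  assumes "approx m A X" and "2 \<le> eps * (real m + 1) \<or> 2 * X < m + 1" "0 < eps"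
  shows "is_approximation eps X A"
proof -
  define a x k where "a = real A" and "x = real X" and "k = real m + 1"
  have "real (m * m * X) \<le> real ((m + 1) * (m + 1) * A)" "a \<le> x"
    using assms(1) of_nat_le_iff unfolding approx_def a_def x_def by blast+
  then have "real m * real m * x \<le> k * k * a"
    unfolding a_def x_def k_def by (simp only: of_nat_mult of_nat_add of_nat_1)
  moreover have "real m = k - 1" by (simp add: k_def)
  ultimately have "(k - 1) * (k - 1) * x \<le> k * k * a" by simp
  moreover have "0 \<le> x" "1 \<le> k" by (auto simp: x_def k_def)
  ultimately have "k * (k * (x - a)) \<le> k * (2 * x)"
    by (simp add: algebra_simps)
  then have k: "k * (x - a) \<le> 2 * x" using \<open>1 \<le> k\<close> by simp
  have "x - a \<le> eps * x"
    using assms(2)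
  proof
    assume "2 \<le> eps * (real m + 1)"
    then have "2 * x \<le> (eps * k) * x" using \<open>0 \<le> x\<close> unfolding k_def by (intro mult_right_mono) auto
    with k have "k * (x - a) \<le> k * (eps * x)" by (simp add: mult_ac)
    then show ?thesis using \<open>1 \<le> k\<close> by simp
  next
    assume "2 * X < m + 1"
    then have "2 * x < k" unfolding x_def k_def by linarith
    then have "k * (x - a) < k * 1" using k by simp
    then have "x - a < 1" using \<open>1 \<le> k\<close> by simp
    then have "X \<le> A" unfolding x_def a_def by linarith
    then have "x - a \<le> 0" by (simp add: x_def a_def)
    also have "0 \<le> eps * x" using assms(3) \<open>0 \<le> x\<close> by simp
    finally show ?thesis .
  qed
  moreover have "0 \<le> eps * x" using assms(3) \<open>0 \<le> x\<close> by simp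
  ultimately show ?thesis
    using \<open>a \<le> x\<close> unfolding is_approximation_def a_def x_def by (simp add: algebra_simps)
qed

lemma precision_accurate:
  fixes eps :: real
  assumes "0 < eps" "eps < 1" "n ^ 4 < 2 ^ w" "X \<le> n ^ 4"
  defines "m \<equiv> precision n w (nat \<lfloor>eps * 2 ^ w\<rfloor>)"
  shows "2 \<le> eps * (real m + 1) \<or> 2 * X < m + 1" and "m \<le> 6 / eps"
proof -
  define e where "e = nat \<lfloor>eps * 2 ^ w\<rfloor>"
  define q where "q = (2 ^ w - 1) div max e 1"
  have m: "m = 2 * (min (n ^ 4) q + 1)" unfolding m_def precision_def q_def e_def by simp
  have e: "real e \<le> eps * 2 ^ w" "eps * 2 ^ w < real e + 1"
  proof -
    have "real e = of_int \<lfloor>eps * 2 ^ w\<rfloor>" using assms unfolding e_def by simp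
    then show "real e \<le> eps * 2 ^ w" "eps * 2 ^ w < real e + 1" by linarith+
  qed
  show "2 \<le> eps * (real m + 1) \<or> 2 * X < m + 1"
  proof (cases "n ^ 4 \<le> q")
    case True
    then have "m = 2 * (n ^ 4 + 1)" unfolding m by simp
    then show ?thesis using assms(4) by simp
  next
    case False
    then have mq: "m = 2 * (q + 1)" unfolding m by simp
    have "e \<noteq> 0"
    proof
      assume "e = 0"
      then have "q = 2 ^ w - 1" unfolding q_def by simp
      then show False using False assms(3) by simp
    qed
    then have "e * q + (2 ^ w - 1) mod e = 2 ^ w - 1" "(2 ^ w - 1) mod e < e"
      unfolding q_def by (simp_all add: max_absorb1)
    then have "2 ^ w - 1 < e * q + e" by linarith
    then have "2 ^ w \<le> e * (q + 1)" by simp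
    then have "real (2 ^ w) \<le> real (e * (q + 1))" using of_nat_le_iff by blast
    also have "\<dots> = real e * (real q + 1)" by (simp only: of_nat_mult of_nat_add of_nat_1)
    \<comment> \<open>Truncating \<open>eps\<close> errs on the safe side: a smaller divisor can
      only increase the precision.\<close>
    also have "\<dots> \<le> (eps * 2 ^ w) * (real q + 1)" using e(1) by (intro mult_right_mono) auto
    finally have "2 ^ w * 1 \<le> 2 ^ w * (eps * (real q + 1))" by (simp add: mult_ac)
    then have "1 \<le> eps * (real q + 1)" by simp
    then have "2 \<le> eps * (real m)" unfolding mq by (simp add: algebra_simps)
    then show ?thesis using assms(1) by (simp add: algebra_simps)
  qed
  \<comment> \<open>For the cost, truncation loses at most a factor 2, also when
    \<open>e = 0\<close>. This gives \<open>eps * q \<le> 2\<close> and then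
    \<open>eps * m \<le> 2 * 2 + 2\<close>.\<close>
  have "eps * 2 ^ w \<le> 2 * real (max e 1)"
    using e by (simp add: max_def)
  then have "eps * (real q * real (max e 1)) \<le> 2 * real (max e 1)"
  proof -
    have "q * max e 1 \<le> 2 ^ w" unfolding q_def by (metis diff_le_self div_times_less_eq_dividend le_trans)
    then have "real (q * max e 1) \<le> real (2 ^ w)" using of_nat_le_iff by blast
    then have "eps * (real q * real (max e 1)) \<le> eps * 2 ^ w"
      using assms by (intro mult_left_mono) auto
    with \<open>eps * 2 ^ w \<le> 2 * real (max e 1)\<close> show ?thesis by linarith
  qed
  then have "(eps * real q) * real (max e 1) \<le> 2 * real (max e 1)" by (simp only: mult.assoc)
  then have "eps * real q \<le> 2"
    by (rule mult_right_le_imp_le) simp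
  moreover have "eps * real (min (n ^ 4) q) \<le> eps * real q" using assms by (intro mult_left_mono) auto
  moreover have "eps * real m = 2 * (eps * real (min (n ^ 4) q)) + 2 * eps"
    unfolding m by (simp add: distrib_left)
  ultimately have "eps * real m \<le> 6" using assms(2) by linarith
  then show "m \<le> 6 / eps" using assms by (simp add: pos_le_divide_eq mult.commute)
qed

text \<open>A number with \<open>K\<close> binary digits is at least \<open>2 ^ (K - 1)\<close>, and
  \<open>n + 2 \<le> 4 * n\<close>; the 3 is \<open>1 + 2\<close>.\<close>

lemma levels_bounds:
  assumes "n \<ge> 1"
  shows "1 \<le> levels (n + 2)" "real (levels (n + 2)) \<le> 3 + log 2 (real n)"
proof -
  define K where "K = levels (n + 2)"
  have "0 < K" unfolding K_def less_levels_iff by simp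
  then show "1 \<le> levels (n + 2)" unfolding K_def by simp
  have "K - 1 < levels (n + 2)" using \<open>0 < K\<close> unfolding K_def by simp
  then have "2 ^ (K - 1) \<le> n + 2" by (simp add: less_levels_iff div_greater_zero_iff)
  also have "\<dots> \<le> 2 ^ 2 * n" using assms by simp
  finally have "real (2 ^ (K - 1)) \<le> real (2 ^ 2 * n)" using of_nat_le_iff by blast
  then have "(2::real) ^ (K - 1) \<le> 4 * real n" by simp
  then have "real (K - 1) \<le> log 2 (4 * real n)" by (rule le_log_of_power) simp
  also have "\<dots> = log 2 (2 ^ 2) + log 2 (real n)" using assms by (simp add: log_mult)
  also have "log 2 (2 ^ 2) = (2::real)" by (subst log_nat_power) auto
  finally have "real (K - 1) \<le> 2 + log 2 (real n)" .
  then show "real (levels (n + 2)) \<le> 3 + log 2 (real n)"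
    using \<open>0 < K\<close> unfolding K_def[symmetric] by simp
qed

section \<open>Running time of the whole program\<close>

context instance_1324
begin

text \<open>\<open>41 * K ^ 2\<close> bounds one evaluation. A binary search multiplies this by
  \<open>K\<close>, and there are at most \<open>m * K + 1\<close> intervals. The constants are
  \<open>103 = 41 + 41 + 9 + 12\<close> and \<open>209 = 2 * 103 + 3\<close>.\<close>

lemma greedy_time_le:
  assumes "1 \<le> m" "1 \<le> K" "tv \<le> 41 * K ^ 2"
  shows "greedy_time tv tb \<le> 209 * (m * K ^ 4) + 2 * m * K * tb"
proof -
  have K4: "K ^ 4 = K * K ^ 3" by (simp add: eval_nat_numeral)
  have pw: "1 \<le> K ^ 3" "K \<le> K ^ 3" "K ^ 2 \<le> K ^ 3" "1 \<le> K ^ 4"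
    using assms power_increasing[of 0 3 K] power_increasing[of 1 3 K] power_increasing[of 2 3 K]
      power_increasing[of 0 4 K] by auto
  have "K * (tv + 9) \<le> K * (41 * K ^ 2) + K * 9"
    using assms(3) by (simp add: distrib_left)
  also have "\<dots> = 41 * K ^ 3 + 9 * K" by (simp add: power3_eq_cube power2_eq_square)
  finally have "tv + K * (tv + 9) + tb + 12 \<le> 103 * K ^ 3 + tb" using assms(3) pw by linarith
  moreover have "m * K + 1 \<le> 2 * (m * K)"
    using mult_le_mono[OF assms(1,2)] by simp
  ultimately have "greedy_time tv tb \<le> 2 * (m * K) * (103 * K ^ 3 + tb) + 3"
    unfolding greedy_time_def by (intro add_right_mono mult_le_mono)
  also have "\<dots> = 206 * (m * K ^ 4) + 2 * m * K * tb + 3"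
    by (simp add: distrib_left K4)
  also have "1 \<le> m * K ^ 4" using mult_le_mono[OF assms(1) pw(4)] by simp
  then have "206 * (m * K ^ 4) + 2 * m * K * tb + 3 \<le> 209 * (m * K ^ 4) + 2 * m * K * tb" by linarith
  finally show ?thesis .
qed

text \<open>The nested cuts dominate: order \<open>m * K\<close> times \<open>m * K\<close> boxes,
  with inner searches of order \<open>K ^ 3\<close>. The constant 1400 rounds up
  \<open>209 + 1084 + 66\<close>, where 66 collects the prologue, the table and the loop
  overheads.\<close>

lemma time_le:
  assumes "1 \<le> m" "1 \<le> K"
  shows "18 + (n * (K * (K * 15 + 10) + 10) + 4 + (n * (position_time + 5) + 4)) \<le> n * (1400 * m ^ 2 * K ^ 5)"
proof -
  have pw: "1 \<le> K ^ 2" "K \<le> K ^ 2" "K ^ 2 \<le> K ^ 3" "K ^ 2 \<le> K ^ 5" "K ^ 4 \<le> K ^ 5" "1 \<le> K ^ 4"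
    using assms power_increasing[of 0 2 K] power_increasing[of 1 2 K] power_increasing[of 2 3 K]
      power_increasing[of 2 5 K] power_increasing[of 4 5 K] power_increasing[of 0 4 K] by auto
  have "query_time = 20 * K ^ 2 + 11 * K + 5"
    unfolding query_time_def by (simp add: distrib_left power2_eq_square)
  then have qt: "query_time + 3 \<le> 41 * K ^ 2" "query_time + 5 \<le> 41 * K ^ 2" "4 * query_time + 22 \<le> 166 * K ^ 3"
    using pw by linarith+
  have K4: "K ^ 4 = K * K ^ 3" "K ^ 5 = K * (K * K ^ 3)" by (simp_all add: eval_nat_numeral)
  have "2 * m * K * (4 * query_time + 22) \<le> 2 * m * K * (166 * K ^ 3)"
    using qt(3) by (rule mult_le_mono2)
  also have "\<dots> = 332 * (m * K ^ 4)" by (simp add: K4)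
  finally have 1: "greedy_time (query_time + 5) (4 * query_time + 22) \<le> 541 * (m * K ^ 4)"
    using greedy_time_le[OF assms qt(2), of "4 * query_time + 22"] by linarith
  have mK: "1 \<le> m * K ^ 4" using mult_le_mono[OF assms(1) pw(6)] by simp
  have "2 * m * K * (greedy_time (query_time + 5) (4 * query_time + 22) + 1) \<le> 2 * m * K * (542 * (m * K ^ 4))"
    using 1 mK by (intro mult_le_mono2) linarith
  also have "\<dots> = 1084 * (m ^ 2 * K ^ 5)" by (simp add: K4 power2_eq_square)
  finally have 2: "position_time \<le> 209 * (m * K ^ 4) + 1084 * (m ^ 2 * K ^ 5)"
    using greedy_time_le[OF assms qt(1), of "greedy_time (query_time + 5) (4 * query_time + 22) + 1"]
    unfolding position_time_def by linarith
  have "m \<le> m ^ 2" "1 \<le> m ^ 2" using assms by (auto simp: power2_eq_square)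
  then have 3: "m * K ^ 4 \<le> m ^ 2 * K ^ 5" "1 * K ^ 2 \<le> m ^ 2 * K ^ 5"
    using pw by (intro mult_le_mono; simp)+
  have "K * (K * 15 + 10) = 15 * K ^ 2 + 10 * K"
    by (simp add: distrib_left power2_eq_square)
  then have "18 + (K * (K * 15 + 10) + 10) + 4 + (position_time + 5) + 4 \<le> 1400 * (m ^ 2 * K ^ 5)"
    using 2 3 pw(1,2) by linarith
  then have "n * (18 + (K * (K * 15 + 10) + 10) + 4 + (position_time + 5) + 4) \<le> n * (1400 * (m ^ 2 * K ^ 5))"
    by (rule mult_le_mono2)
  moreover have "18 \<le> n * 18" "4 \<le> n * 4" using n_pos by auto
  ultimately show ?thesis by (simp add: distrib_left mult.assoc)
qed

lemma wp_count_copies: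
  assumes "R 0 = n" "R 1 = e" "\<And>r. 2 \<le> r \<Longrightarrow> R r = 0" "m = precision n w e"
  shows "wp w count_copies (\<lambda>t R' M'. t \<le> n * (1400 * m ^ 2 * K ^ 5) \<and>
    approx m (R' 0) (card (copies_1324 n p))) R input_mem"
proof -
  have m: "1 \<le> m" unfolding assms(4) precision_def by simp
  have K1: "1 \<le> K" using levels_bounds(1)[OF n_pos] by (simp add: K_def N_def)
  have "wp w prologue (\<lambda>t R' M'. t \<le> 18 \<and> M' = input_mem \<and> R' 0 = 0 \<and> env R') R input_mem"
    using wp_prologue[OF n_pos word assms(1-3), of input_mem]
  proof (rule wp_mono)
    fix t :: nat and R' M' :: store
    assume a: "t \<le> 18 \<and> M' = input_mem \<and> R' 0 = 0 \<and> R' 2 = n \<and> R' 3 = n + 2 \<and>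
      R' 4 = 1 \<and> R' 5 = 0 \<and> R' 6 = 2 \<and> R' 7 = precision n w e + 1 \<and> R' 8 = precision n w e"
    then have "env R'" using assms(4)[symmetric] by (simp add: env_def N_def)
    with a show "t \<le> 18 \<and> M' = input_mem \<and> R' 0 = 0 \<and> env R'" by blast
  qed
  then have "wp w prologue (\<lambda>t. wp w fill_table (\<lambda>u. wp w add_all (\<lambda>v R' M'.
    t + (u + v) \<le> n * (1400 * m ^ 2 * K ^ 5) \<and> approx m (R' 0) (card (copies_1324 n p))))) R input_mem"
  proof (rule wp_mono)
    fix t :: nat and R1 M1 :: store
    assume 1: "t \<le> 18 \<and> M1 = input_mem \<and> R1 0 = 0 \<and> env R1"
    then have "wp w fill_table (\<lambda>t R' M'. t \<le> n * (K * (K * 15 + 10) + 10) + 4 \<and>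
      (\<forall>r<9. R' r = R1 r) \<and> table M') R1 M1" using wp_fill_table by blast
    then show "wp w fill_table (\<lambda>u. wp w add_all (\<lambda>v R' M'.
      t + (u + v) \<le> n * (1400 * m ^ 2 * K ^ 5) \<and> approx m (R' 0) (card (copies_1324 n p)))) R1 M1"
    proof (rule wp_mono)
      fix u :: nat and R2 M2 :: store
      assume 2: "u \<le> n * (K * (K * 15 + 10) + 10) + 4 \<and> (\<forall>r<9. R2 r = R1 r) \<and> table M2"
      have "env R2" by (rule env_cong[of R1]) (use 1 2 in auto)
      moreover have "R2 0 = 0" using 1 2 by simp
      ultimately have "wp w add_all (\<lambda>t R' M'. t \<le> n * (position_time + 5) + 4 \<and>
        approx m (R' 0) (card (copies_1324 n p))) R2 M2"
        using wp_add_all m 2 by blast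
      then show "wp w add_all (\<lambda>v R' M'.
        t + (u + v) \<le> n * (1400 * m ^ 2 * K ^ 5) \<and> approx m (R' 0) (card (copies_1324 n p))) R2 M2"
        by (rule wp_mono) (use 1 2 time_le[OF m K1] in linarith)
    qed
  qed
  moreover have "wp w (fill_table ;; add_all) Q = wp w fill_table (\<lambda>t. wp w add_all (\<lambda>u. Q (t + u)))" for Q
    by (intro ext) simp
  ultimately show ?thesis unfolding count_copies_def by simp
qed

end

text \<open>The inequality \<open>n + 2 \<le> (n + 1) ^ 2\<close> turns the exponent 8 into the 16
  required of the word size.\<close>

lemma word_bound:
  assumes "real w \<ge> 16 * log 2 (real (n + 1))" "n \<ge> 1"
  shows "(n + 2) ^ 8 \<le> (2::nat) ^ w"
proof -
  have "n + 2 \<le> (n + 1) ^ 2" using assms(2) by (simp add: power2_eq_square)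
  then have "(n + 2) ^ 8 \<le> ((n + 1) ^ 2) ^ 8" by (rule power_mono) simp
  also have "\<dots> = (n + 1) ^ 16" by (simp flip: power_mult)
  finally have 1: "(n + 2) ^ 8 \<le> (n + 1) ^ 16" .
  have "log 2 (real (n + 1) ^ 16) \<le> real w" using assms by (simp add: log_nat_power)
  then have "2 powr log 2 (real (n + 1) ^ 16) \<le> 2 powr real w" by (intro powr_mono) auto
  then have "real (n + 1) ^ 16 \<le> 2 ^ w" by (simp add: powr_realpow del: of_nat_Suc of_nat_add)
  then have "real ((n + 1) ^ 16) \<le> real (2 ^ w)" by simp
  then have "(n + 1) ^ 16 \<le> (2::nat) ^ w" using of_nat_le_iff by blast
  with 1 show ?thesis by linarith
qed

text \<open>For \<open>n = 1\<close> the quotient \<open>log 2 n / eps\<close> is 0 and carries no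
  information on \<open>eps\<close>, so \<open>m\<close> has to be bounded outright. For
  \<open>n \<ge> 2\<close> both the logarithm and \<open>1 / eps\<close> are at most the quotient;
  the constant is \<open>1400 * 6 ^ 2 * 4 ^ 5\<close>, and the exponent is
  \<open>2 + 5\<close>.\<close>

lemma polylog_bound:
  fixes eps :: real
  assumes "n \<ge> 1" "0 < eps" "eps < 1" "real m \<le> 6 / eps" "n = 1 \<Longrightarrow> m \<le> 4"
    and "real k \<le> 3 + log 2 (real n)"
  shows "real (1400 * m ^ 2 * k ^ 5) \<le> 51609600 + 51609600 * (log 2 (real n) / eps) ^ 7"
proof (cases "n = 1")
  case True
  then have "k \<le> 3" using assms(6) by simp
  then have "m ^ 2 * k ^ 5 \<le> 4 ^ 2 * 3 ^ 5" using assms(5) True by (intro mult_le_mono power_mono) auto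
  then have "real (m ^ 2 * k ^ 5) \<le> real (4 ^ 2 * 3 ^ 5)" using of_nat_le_iff by blast
  then show ?thesis using True by simp
next
  case False
  define z where "z = log 2 (real n) / eps"
  have L: "1 \<le> log 2 (real n)" using False assms(1) by simp
  have Lz: "log 2 (real n) \<le> z"
    unfolding z_def using L assms by (simp add: field_simps)
  have "1 / eps \<le> z" unfolding z_def using L assms by (simp add: divide_right_mono)
  then have mz: "real m \<le> 6 * z" using assms(4) by simp
  have "real k \<le> 4 * z" "0 \<le> z" using assms(6) L Lz by linarith+
  with mz have "real m ^ 2 * real k ^ 5 \<le> (6 * z) ^ 2 * (4 * z) ^ 5"
    by (intro mult_mono power_mono) auto
  also have "\<dots> = 36864 * z ^ 7" by (simp add: power_mult_distrib eval_nat_numeral)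
  finally show ?thesis unfolding z_def by simp
qed

theorem theorem3p4:
  shows "\<exists>(P :: instr list) (c :: nat) (q :: real poly). c \<ge> 1 \<and>
    (\<forall>(n :: nat) (p :: nat \<Rightarrow> nat) (eps :: real) (w :: nat).
       n \<ge> 1 \<longrightarrow> p permutes {1..n} \<longrightarrow> 0 < eps \<longrightarrow> eps < 1 \<longrightarrow>
       real w \<ge> real c * log 2 (real (n + 1)) \<longrightarrow>
       (\<exists>(t :: nat) (v :: nat).
          outputs_within w P (initial_state w n p eps) t v \<and>
          real t \<le> real n * poly q (log 2 (real n) / eps) \<and>
          is_approximation eps (real (card (copies_1324 n p))) (real v)))"
proof (rule exI[of _ "compile 0 count_copies"], rule exI[of _ 16],
    rule exI[of _ "[:51609600:] + monom 51609600 7"], intro conjI allI impI)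
  let ?P = "compile 0 count_copies"
  let ?q = "[:51609600:] + monom 51609600 7 :: real poly"
  show "(1::nat) \<le> 16" by simp
  fix n :: nat and p :: "nat \<Rightarrow> nat" and eps :: real and w :: nat
  assume n: "n \<ge> 1" and perm: "p permutes {1..n}" and eps: "0 < eps" "eps < 1"
    and w: "real w \<ge> real 16 * log 2 (real (n + 1))"
  define e where "e = nat \<lfloor>eps * 2 ^ w\<rfloor>"
  define m where "m = precision n w e"
  have word: "(n + 2) ^ 8 \<le> (2::nat) ^ w" using word_bound w n by simp
  interpret instance_1324 n w m p
    using n perm word precision_le[OF n] by unfold_locales (auto simp: m_def)
  have "n ^ 4 < 2 ^ w" by (rule pow_less_word[of _ 4]) (use N_ge in \<open>auto intro!: power_strict_mono\<close>)
  note acc = precision_accurate[OF eps this copies_le, folded e_def m_def]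
  define R0 where "R0 = (\<lambda>_::nat. 0::nat)(0 := n, 1 := e)"
  have init: "initial_state w n p eps = \<lparr>pc = 0, reg = R0, mem = input_mem\<rparr>"
    unfolding initial_state_def R0_def e_def input_mem_def by simp
  have "wp w count_copies (\<lambda>t R' M'. t \<le> n * (1400 * m ^ 2 * K ^ 5) \<and>
    approx m (R' 0) (card (copies_1324 n p))) R0 input_mem"
    by (rule wp_count_copies) (auto simp: R0_def m_def)
  then obtain t R' M' where run: "exec w count_copies R0 input_mem t R' M'"
    and t: "t \<le> n * (1400 * m ^ 2 * K ^ 5)" and ap: "approx m (R' 0) (card (copies_1324 n p))"
    unfolding wp_def by blast
  have "(step w ?P ^^ t) (initial_state w n p eps) =
      \<lparr>pc = code_size count_copies, reg = R', mem = M'\<rparr>"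
    using compile_correct[OF run, of ?P "[]" "[]"] unfolding init by simp
  then have out: "outputs_within w ?P (initial_state w n p eps) t (R' 0)"
    unfolding outputs_within_def halted_def by simp
  have "real t \<le> real (n * (1400 * m ^ 2 * K ^ 5))" using t of_nat_le_iff by blast
  then have "real t \<le> real n * real (1400 * m ^ 2 * K ^ 5)" by (simp only: of_nat_mult)
  also have "\<dots> \<le> real n * (51609600 + 51609600 * (log 2 (real n) / eps) ^ 7)"
  proof (intro mult_left_mono polylog_bound n eps acc(2))
    \<comment> \<open>Here the cap \<open>n ^ 4\<close> is 1, whatever \<open>eps\<close>
      is.\<close>
    show "m \<le> 4" if "n = 1"
      unfolding m_def precision_def that by simp
    show "real K \<le> 3 + log 2 (real n)" using levels_bounds(2)[OF n] by (simp add: K_def N_def)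
  qed simp
  finally have "real t \<le> real n * poly ?q (log 2 (real n) / eps)" by (simp add: poly_monom)
  moreover have "is_approximation eps (real (card (copies_1324 n p))) (real (R' 0))"
    using ap acc(1) eps(1) by (rule approx_approximation)
  ultimately show "\<exists>(t :: nat) (v :: nat).
          outputs_within w ?P (initial_state w n p eps) t v \<and>
          real t \<le> real n * poly ?q (log 2 (real n) / eps) \<and>
          is_approximation eps (real (card (copies_1324 n p))) (real v)"
    using out by blast
qed

end
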